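(* Fix a non-identity Pauli string $\mathbf R\in\mathcal P_n$ with $|\operatorname{supp}(\mathbf R)|\le k$, and consider the one-parameter Hamiltonian subfamily of Lindblad generators $$\mathcal L_\theta(\rho):=-i[\theta\mathbf R,\rho],\qquad\theta\in\mathbb R .$$ There is a universal constant $c>0$ such that the following holds for every $\varepsilon_1>0$ and $t_{\max}>0$. Any adaptive protocol that uses tensor-product input states, evolutions of duration $t\le t_{\max}$, and single-qubit Pauli measurements, and that outputs an estimator $\widehat\chi_{\mathbf R,I}$ satisfying $$\Pr_\theta\bigl[\,|\widehat\chi_{\mathbf R,I}-\chi_{\mathbf R,I}|\le\varepsilon_1\bigr]\ge\frac23$$ uniformly over $\theta\in\{-2\varepsilon_1,+2\varepsilon_1\}$, requires at least $\dfrac{c}{t_{\max}^2\varepsilon_1^2}$ samples.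
   Context: $\mathcal P_n=\{I,X,Y,Z\}^{\otimes n}$ is the set of $n$-qubit Pauli strings and $\operatorname{supp}(\mathbf R)$ the set of qubits on which $\mathbf R$ acts nontrivially. The coefficients $\chi_{\mathbf P,\mathbf Q}$ of a superoperator $\mathcal K$ on $\mathbb M_{2^n}$ are defined by $\mathcal K(M)=\sum_{\mathbf P,\mathbf Q\in\mathcal P_n}\chi_{\mathbf P,\mathbf Q}\,\mathbf P M\mathbf Q$; $\chi_{\mathbf R,I}$ is that of $\mathcal L_\theta$. One sample (shot) consists of preparing a tensor-product $n$-qubit state, evolving it by $e^{t\mathcal L_\theta}$ for a time $0\le t\le t_{\max}$, and performing a tensor product of single-qubit Pauli measurements. The choices of input state, evolution time and measurement may depend adaptively on all previous outcomes. $\Pr_\theta$ is the probability over the protocol's outcomes when the generator is $\mathcal L_\theta$. *)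

theory Defs
  imports
    "HOL-Probability.Probability_Measure"
    "Jordan_Normal_Form.Schur_Decomposition"
begin

section \<open>Pauli strings\<close>

datatype pauli = PauliI | PauliX | PauliY | PauliZ

fun pauli_mat :: "pauli \<Rightarrow> complex mat" where
  "pauli_mat PauliI = mat_of_rows_list 2 [[1, 0], [0, 1]]"
| "pauli_mat PauliX = mat_of_rows_list 2 [[0, 1], [1, 0]]"
| "pauli_mat PauliY = mat_of_rows_list 2 [[0, - \<i>], [\<i>, 0]]"
| "pauli_mat PauliZ = mat_of_rows_list 2 [[1, 0], [0, - 1]]"

definition kron :: "complex mat \<Rightarrow> complex mat \<Rightarrow> complex mat" where
  "kron A B = mat (dim_row A * dim_row B) (dim_col A * dim_col B)
     (\<lambda>(i, j). A $$ (i div dim_row B, j div dim_col B) * B $$ (i mod dim_row B, j mod dim_col B))"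

definition tensor_list :: "complex mat list \<Rightarrow> complex mat" where
  "tensor_list As = foldr kron As (1\<^sub>m 1)"

definition pauli_strings :: "nat \<Rightarrow> pauli list set" where
  "pauli_strings n = {P. length P = n}"

definition pauli_id :: "nat \<Rightarrow> pauli list" where
  "pauli_id n = replicate n PauliI"

definition pauli_supp :: "pauli list \<Rightarrow> nat set" where
  "pauli_supp P = {q. q < length P \<and> P ! q \<noteq> PauliI}"

definition pauli_string_mat :: "pauli list \<Rightarrow> complex mat" where
  "pauli_string_mat P = tensor_list (map pauli_mat P)"

section \<open>Superoperators\<close>

type_synonym superop = "complex mat \<Rightarrow> complex mat"

definition is_chi_matrix :: "nat \<Rightarrow> superop \<Rightarrow> (pauli list \<Rightarrow> pauli list \<Rightarrow> complex) \<Rightarrow> bool" where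
  "is_chi_matrix n K chi \<longleftrightarrow>
     (\<forall>M \<in> carrier_mat (2 ^ n) (2 ^ n). \<forall>i < 2 ^ n. \<forall>j < 2 ^ n.
        K M $$ (i, j) =
          (\<Sum>P \<in> pauli_strings n. \<Sum>Q \<in> pauli_strings n.
             chi P Q * (pauli_string_mat P * M * pauli_string_mat Q) $$ (i, j)))"

text \<open>The maps \<open>M \<mapsto> P M Q\<close> form a basis of the linear superoperators, so for linear \<open>K\<close> the
  expansion fixes the coefficients on strings of length \<open>n\<close>. The value 0 elsewhere makes the
  function, and hence the description, unique.\<close>

definition chi_matrix :: "nat \<Rightarrow> superop \<Rightarrow> pauli list \<Rightarrow> pauli list \<Rightarrow> complex" where
  "chi_matrix n K = (THE chi. is_chi_matrix n K chi \<and>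
     (\<forall>P Q. P \<notin> pauli_strings n \<or> Q \<notin> pauli_strings n \<longrightarrow> chi P Q = 0))"

text \<open>\<open>exp (t K)\<close> as the entrywise power series; \<open>d\<close> is the dimension of the Hilbert space.\<close>

definition superop_exp :: "nat \<Rightarrow> real \<Rightarrow> superop \<Rightarrow> superop" where
  "superop_exp d t K M =
     mat d d (\<lambda>(i, j). \<Sum>m. of_real (t ^ m / fact m) * ((K ^^ m) M) $$ (i, j))"

definition hamiltonian_generator :: "pauli list \<Rightarrow> real \<Rightarrow> superop" where
  "hamiltonian_generator R \<theta> \<rho> =
     (let H = of_real \<theta> \<cdot>\<^sub>m pauli_string_mat R in (- \<i>) \<cdot>\<^sub>m (H * \<rho> - \<rho> * H))"

section \<open>Shots\<close>

definition trace :: "complex mat \<Rightarrow> complex" where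
  "trace A = (\<Sum>i < dim_row A. A $$ (i, i))"

definition density_matrix :: "nat \<Rightarrow> complex mat \<Rightarrow> bool" where
  "density_matrix d \<rho> \<longleftrightarrow>
     \<rho> \<in> carrier_mat d d \<and> mat_adjoint \<rho> = \<rho> \<and>
     (\<forall>v \<in> carrier_vec d. Re ((\<rho> *\<^sub>v v) \<bullet>c v) \<ge> 0) \<and> trace \<rho> = 1"

text \<open>The experimenter's choices for one shot: the single-qubit factors of the input state, the
  evolution time, and the Pauli measured on each qubit.\<close>

record setting =
  input_factors :: "complex mat list"
  duration :: real
  bases :: "pauli list"

definition valid_setting :: "nat \<Rightarrow> real \<Rightarrow> setting \<Rightarrow> bool" where
  "valid_setting n tmax s \<longleftrightarrow>
     length (input_factors s) = n \<and> (\<forall>\<rho> \<in> set (input_factors s). density_matrix 2 \<rho>) \<and>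
     0 \<le> duration s \<and> duration s \<le> tmax \<and>
     length (bases s) = n \<and> set (bases s) \<subseteq> {PauliX, PauliY, PauliZ}"

text \<open>The outcome of a shot lists one bit per qubit; \<open>True\<close> stands for the eigenvalue \<open>+1\<close>.\<close>

type_synonym outcome = "bool list"

definition pauli_projector :: "pauli \<Rightarrow> bool \<Rightarrow> complex mat" where
  "pauli_projector P b = (1 / 2) \<cdot>\<^sub>m (1\<^sub>m 2 + (if b then 1 else - 1) \<cdot>\<^sub>m pauli_mat P)"

definition shot_prob :: "nat \<Rightarrow> superop \<Rightarrow> setting \<Rightarrow> outcome \<Rightarrow> real" where
  "shot_prob n L s b =
     Re (trace (tensor_list (map2 pauli_projector (bases s) b) *
                superop_exp (2 ^ n) (duration s) L (tensor_list (input_factors s))))"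

section \<open>Adaptive protocols\<close>

text \<open>A protocol may be randomised: its internal randomness is a seed drawn once at the start.
  Given the seed, the setting of the next shot is a function of the outcomes so far, and the
  estimate is a function of all outcomes. A deterministic protocol ignores the seed.\<close>

record protocol =
  seed :: "real measure"
  next_setting :: "real \<Rightarrow> outcome list \<Rightarrow> setting"
  estimate :: "real \<Rightarrow> outcome list \<Rightarrow> complex"

definition outcome_seqs :: "nat \<Rightarrow> nat \<Rightarrow> outcome list set" where
  "outcome_seqs n m = {os. length os = m \<and> (\<forall>b \<in> set os. length b = n)}"

definition valid_protocol :: "nat \<Rightarrow> real \<Rightarrow> nat \<Rightarrow> protocol \<Rightarrow> bool" where
  "valid_protocol n tmax N p \<longleftrightarrow>
     prob_space (seed p) \<and>
     (\<forall>m < N. \<forall>os \<in> outcome_seqs n m.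
        (\<forall>\<omega> \<in> space (seed p). valid_setting n tmax (next_setting p \<omega> os)) \<and>
        (\<forall>q < n. \<forall>i < 2. \<forall>j < 2.
           (\<lambda>\<omega>. (input_factors (next_setting p \<omega> os) ! q) $$ (i, j)) \<in> borel_measurable (seed p)) \<and>
        (\<lambda>\<omega>. duration (next_setting p \<omega> os)) \<in> borel_measurable (seed p) \<and>
        (\<lambda>\<omega>. bases (next_setting p \<omega> os)) \<in> measurable (seed p) (count_space UNIV)) \<and>
     (\<forall>os \<in> outcome_seqs n N. (\<lambda>\<omega>. estimate p \<omega> os) \<in> borel_measurable (seed p))"

definition path_prob :: "nat \<Rightarrow> superop \<Rightarrow> protocol \<Rightarrow> real \<Rightarrow> outcome list \<Rightarrow> real" where
  "path_prob n L p \<omega> os =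
     (\<Prod>m < length os. shot_prob n L (next_setting p \<omega> (take m os)) (os ! m))"

text \<open>The probability that the estimate after \<open>N\<close> shots satisfies \<open>E\<close>, when the generator is \<open>L\<close>.\<close>

definition estimate_prob ::
  "nat \<Rightarrow> superop \<Rightarrow> nat \<Rightarrow> protocol \<Rightarrow> (complex \<Rightarrow> bool) \<Rightarrow> real" where
  "estimate_prob n L N p E =
     (\<integral>\<omega>. (\<Sum>os \<in> {os \<in> outcome_seqs n N. E (estimate p \<omega> os)}. path_prob n L p \<omega> os) \<partial>seed p)"

end

theory Submission
  imports Defs
begin

text \<open>The two generators differ in the sign of \<open>\<theta> = 2\<epsilon>\<^sub>1\<close>, and \<open>\<chi>\<close> takes the values \<open>\<minusplus>2\<i>\<epsilon>\<^sub>1\<close>, so a successful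
  estimator tests one against the other. With \<open>c = cos \<theta>t\<close> and \<open>s = sin \<theta>t\<close>, the outcome with projector \<open>\<Pi>\<close> has
  probability \<open>c\<^sup>2 u + s\<^sup>2 v \<minusplus> 2 s c Im w\<close> where \<open>u = tr \<Pi>\<rho>\<close>, \<open>v = tr \<Pi>R\<rho>R\<close>, \<open>w = tr \<Pi>\<rho>R\<close>. As everything is
  a tensor product, these factor over the qubits, so \<open>\<bar>w\<bar>\<^sup>2 \<le> u v\<close> only has to be checked on one
  qubit. Hence the geometric mean of the two probabilities is at least \<open>c\<^sup>2 u - s\<^sup>2 v\<close>, and the
  Bhattacharyya affinity of one shot is at least \<open>1 - 2 s\<^sup>2 \<ge> 1 - 8 \<epsilon>\<^sub>1\<^sup>2 t\<^sup>2\<close>. Each of the \<open>N\<close> adaptive shots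
  lowers the affinity by at most \<open>8 \<epsilon>\<^sub>1\<^sup>2 t\<^sub>m\<^sub>a\<^sub>x\<^sup>2\<close>, whereas distinguishing the two generators with error
  1/3 forces it down by a constant.\<close>

section \<open>Kronecker products\<close>

lemma index_mult_mat_sum:
  assumes "A \<in> carrier_mat a k" "B \<in> carrier_mat k c" "i < a" "j < c"
  shows "(A * B) $$ (i, j) = (\<Sum>l<k. A $$ (i, l) * B $$ (l, j))"
  using assms by (auto simp: scalar_prod_def atLeast0LessThan)

text \<open>Quotient and remainder identify the index of a Kronecker product with a pair of factor
  indices, so a sum over the composite index becomes a double sum.\<close>

lemma sum_div_mod:
  fixes f :: "nat \<Rightarrow> nat \<Rightarrow> 'a::comm_monoid_add"
  shows "(\<Sum>i<m * n. f (i div n) (i mod n)) = (\<Sum>a<m. \<Sum>b<n. f a b)"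
proof -
  have "(\<Sum>i<m * n. f (i div n) (i mod n)) = (\<Sum>(a, b)\<in>{..<m} \<times> {..<n}. f a b)"
  proof (rule sum.reindex_bij_witness[where j = "\<lambda>i. (i div n, i mod n)" and i = "\<lambda>(a, b). a * n + b"])
    fix i assume i: "i \<in> {..<m * n}"
    then have "n > 0" by (cases n) auto
    then show "(i div n, i mod n) \<in> {..<m} \<times> {..<n}"
      using i by (auto simp: less_mult_imp_div_less)
  next
    fix ab assume "ab \<in> {..<m} \<times> {..<n}"
    then obtain a b where ab: "ab = (a, b)" "a < m" "b < n" by auto
    have "a * n + b < Suc a * n" using ab by simp
    also have "\<dots> \<le> m * n" using ab by (intro mult_le_mono1) simp
    finally show "(case ab of (a, b) \<Rightarrow> a * n + b) \<in> {..<m * n}" using ab by simp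
  qed auto
  then show ?thesis by (simp add: sum.cartesian_product)
qed

lemma kron_carrier [simp]:
  assumes "A \<in> carrier_mat a b" "B \<in> carrier_mat c d"
  shows "kron A B \<in> carrier_mat (a * c) (b * d)"
  using assms by (auto simp: kron_def)

text \<open>The mixed-product property: each summand of an entry splits into a factor depending only
  on the quotient of the summation index and one depending only on its remainder, so the whole sum
  is a product of two sums.\<close>

lemma kron_mult:
  assumes A: "A \<in> carrier_mat a k" and B: "B \<in> carrier_mat b l"
    and C: "C \<in> carrier_mat k c" and D: "D \<in> carrier_mat l d"
  shows "kron A B * kron C D = kron (A * C) (B * D)"
proof (rule eq_matI)
  have dims: "kron A B \<in> carrier_mat (a * b) (k * l)" "kron C D \<in> carrier_mat (k * l) (c * d)"
      "A * C \<in> carrier_mat a c" "B * D \<in> carrier_mat b d"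
    using assms by auto
  have K: "kron (A * C) (B * D) \<in> carrier_mat (a * b) (c * d)"
    using dims by auto
  fix i j assume "i < dim_row (kron (A * C) (B * D))" "j < dim_col (kron (A * C) (B * D))"
  with K have ij: "i < a * b" "j < c * d" by auto
  then have pos: "b > 0" "d > 0" by (cases b, auto, cases d, auto)
  then have dm: "i div b < a" "i mod b < b" "j div d < c" "j mod d < d"
    using ij by (auto simp: less_mult_imp_div_less)
  have "(kron A B * kron C D) $$ (i, j) =
      (\<Sum>r<k * l. kron A B $$ (i, r) * kron C D $$ (r, j))"
    using index_mult_mat_sum[OF dims(1,2) ij] .
  also have "\<dots> = (\<Sum>r<k * l. (A $$ (i div b, r div l) * C $$ (r div l, j div d)) *
      (B $$ (i mod b, r mod l) * D $$ (r mod l, j mod d)))"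
    using assms ij by (intro sum.cong) (auto simp: kron_def)
  also have "\<dots> = (\<Sum>x<k. \<Sum>y<l. (A $$ (i div b, x) * C $$ (x, j div d)) *
      (B $$ (i mod b, y) * D $$ (y, j mod d)))"
    by (rule sum_div_mod)
  also have "\<dots> = (A * C) $$ (i div b, j div d) * (B * D) $$ (i mod b, j mod d)"
    using index_mult_mat_sum[OF A C dm(1,3)] index_mult_mat_sum[OF B D dm(2,4)]
    by (simp add: sum_product)
  also have "\<dots> = kron (A * C) (B * D) $$ (i, j)"
    using ij assms by (simp add: kron_def)
  finally show "(kron A B * kron C D) $$ (i, j) = kron (A * C) (B * D) $$ (i, j)" .
qed (use assms in \<open>auto simp: kron_def\<close>)

lemma trace_kron:
  assumes "A \<in> carrier_mat a a" "B \<in> carrier_mat b b"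
  shows "trace (kron A B) = trace A * trace B"
proof -
  have "trace (kron A B) = (\<Sum>i<a * b. A $$ (i div b, i div b) * B $$ (i mod b, i mod b))"
    using assms by (auto simp: trace_def kron_def intro!: sum.cong)
  also have "\<dots> = (\<Sum>i<a. \<Sum>j<b. A $$ (i, i) * B $$ (j, j))"
    by (rule sum_div_mod)
  finally show ?thesis
    using assms by (auto simp: trace_def sum_product)
qed

section \<open>Tensor products of lists of matrices\<close>

lemma tensor_list_simps [simp]:
  "tensor_list [] = 1\<^sub>m 1" "tensor_list (A # As) = kron A (tensor_list As)"
  by (auto simp: tensor_list_def)

lemma tensor_list_carrier:
  assumes "set As \<subseteq> carrier_mat d d"
  shows "tensor_list As \<in> carrier_mat (d ^ length As) (d ^ length As)"
  using assms by (induction As) auto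

lemma tensor_list_mult:
  assumes "length As = length Bs" "set As \<subseteq> carrier_mat d d" "set Bs \<subseteq> carrier_mat d d"
  shows "tensor_list As * tensor_list Bs = tensor_list (map2 (*) As Bs)"
  using assms
proof (induction As Bs rule: list_induct2)
  case (Cons A As B Bs)
  then have "tensor_list As \<in> carrier_mat (d ^ length As) (d ^ length As)"
      "tensor_list Bs \<in> carrier_mat (d ^ length As) (d ^ length As)"
    using tensor_list_carrier[of As d] tensor_list_carrier[of Bs d] by auto
  with Cons show ?case
    using kron_mult[of A d d "tensor_list As" _ _ B d "tensor_list Bs"] by simp
qed simp

lemma trace_tensor_list:
  assumes "set As \<subseteq> carrier_mat d d"
  shows "trace (tensor_list As) = (\<Prod>q<length As. trace (As ! q))"
  using assms
proof (induction As)
  case Nil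
  then show ?case by (simp add: trace_def)
next
  case (Cons A As)
  then show ?case
    using trace_kron[OF _ tensor_list_carrier[of As d], of A d]
    by (simp add: prod.lessThan_Suc_shift del: prod.lessThan_Suc)
qed

lemma set_map2_mult_carrier:
  assumes "set As \<subseteq> carrier_mat d d" "set Bs \<subseteq> carrier_mat d d"
  shows "set (map2 (*) As Bs) \<subseteq> carrier_mat d d"
  using assms by (force dest: set_zip_leftD set_zip_rightD)

lemma kron_one: "kron (1\<^sub>m a) (1\<^sub>m b) = 1\<^sub>m (a * b)"
proof (rule eq_matI)
  fix i j assume "i < dim_row (1\<^sub>m (a * b) :: complex mat)" "j < dim_col (1\<^sub>m (a * b) :: complex mat)"
  then have ij: "i < a * b" "j < a * b" by auto
  then have "b > 0" by (cases b) auto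
  moreover have "i = j \<longleftrightarrow> i div b = j div b \<and> i mod b = j mod b"
    by (metis div_mult_mod_eq)
  ultimately show "kron (1\<^sub>m a) (1\<^sub>m b) $$ (i, j) = 1\<^sub>m (a * b) $$ (i, j)"
    using ij by (auto simp: kron_def less_mult_imp_div_less)
qed (auto simp: kron_def)

lemma tensor_list_replicate_one: "tensor_list (replicate n (1\<^sub>m d)) = 1\<^sub>m (d ^ n)"
  by (induction n) (auto simp: kron_one)

lemma trace_mult:
  assumes "A \<in> carrier_mat a b" "B \<in> carrier_mat b a"
  shows "trace (A * B) = (\<Sum>i<a. \<Sum>j<b. A $$ (i, j) * B $$ (j, i))"
  using assms index_mult_mat_sum[OF assms] by (auto simp: trace_def intro!: sum.cong)

section \<open>Two-by-two matrices\<close>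

lemma lessThan_two: "{..<2::nat} = {0, 1}"
  by auto

lemma eq_mat2I:
  assumes "A \<in> carrier_mat 2 2" "B \<in> carrier_mat 2 2"
    "A $$ (0, 0) = B $$ (0, 0)" "A $$ (0, 1) = B $$ (0, 1)"
    "A $$ (1, 0) = B $$ (1, 0)" "A $$ (1, 1) = B $$ (1, 1)"
  shows "A = B"
  using assms by (intro eq_matI) (auto simp: less_2_cases_iff)

lemma mult_mat2_index:
  assumes "A \<in> carrier_mat 2 2" "B \<in> carrier_mat 2 2" "i < 2" "j < 2"
  shows "(A * B) $$ (i, j) = A $$ (i, 0) * B $$ (0, j) + A $$ (i, 1) * B $$ (1, j)"
  using index_mult_mat_sum[OF assms] by (simp add: lessThan_two)

section \<open>Pauli strings and the chi matrix\<close>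

lemma pauli_mat_carrier [simp]: "pauli_mat P \<in> carrier_mat 2 2"
  by (cases P) (auto simp: mat_of_rows_list_def)

lemma pauli_mat_dim [simp]: "dim_row (pauli_mat P) = 2" "dim_col (pauli_mat P) = 2"
  using carrier_matD[OF pauli_mat_carrier] by auto

lemma pauli_mat_index [simp]:
  "pauli_mat P $$ (0, 0) = (case P of PauliI \<Rightarrow> 1 | PauliX \<Rightarrow> 0 | PauliY \<Rightarrow> 0 | PauliZ \<Rightarrow> 1)"
  "pauli_mat P $$ (0, Suc 0) = (case P of PauliI \<Rightarrow> 0 | PauliX \<Rightarrow> 1 | PauliY \<Rightarrow> - \<i> | PauliZ \<Rightarrow> 0)"
  "pauli_mat P $$ (Suc 0, 0) = (case P of PauliI \<Rightarrow> 0 | PauliX \<Rightarrow> 1 | PauliY \<Rightarrow> \<i> | PauliZ \<Rightarrow> 0)"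
  "pauli_mat P $$ (Suc 0, Suc 0) = (case P of PauliI \<Rightarrow> 1 | PauliX \<Rightarrow> 0 | PauliY \<Rightarrow> 0 | PauliZ \<Rightarrow> - 1)"
  by (cases P; simp add: mat_of_rows_list_def)+

lemma pauli_mat_sq: "pauli_mat P * pauli_mat P = 1\<^sub>m 2"
proof (rule eq_mat2I)
  show "pauli_mat P * pauli_mat P \<in> carrier_mat 2 2"
    using pauli_mat_carrier by (rule mult_carrier_mat) simp
qed (cases P; simp add: mult_mat2_index[OF pauli_mat_carrier pauli_mat_carrier]
    del: pauli_mat.simps index_mult_mat)+

lemma trace_pauli_mat_mult: "trace (pauli_mat P * pauli_mat Q) = (if P = Q then 2 else 0)"
  by (cases P; cases Q)
    (auto simp: trace_mult[OF pauli_mat_carrier pauli_mat_carrier] lessThan_two simp del: pauli_mat.simps)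

lemma set_map_pauli_mat: "set (map pauli_mat P) \<subseteq> carrier_mat 2 2"
  by auto

lemma pauli_string_mat_carrier:
  "P \<in> pauli_strings n \<Longrightarrow> pauli_string_mat P \<in> carrier_mat (2 ^ n) (2 ^ n)"
  using tensor_list_carrier[OF set_map_pauli_mat, of P]
  by (simp add: pauli_string_mat_def pauli_strings_def)

lemma pauli_string_mat_id: "pauli_string_mat (pauli_id n) = 1\<^sub>m (2 ^ n)"
proof -
  have "pauli_mat PauliI = 1\<^sub>m 2"
    by (rule eq_mat2I) (auto simp del: pauli_mat.simps)
  then show ?thesis
    by (simp add: pauli_string_mat_def pauli_id_def tensor_list_replicate_one del: pauli_mat.simps)
qed

lemma pauli_string_mat_sq:
  assumes "P \<in> pauli_strings n"
  shows "pauli_string_mat P * pauli_string_mat P = 1\<^sub>m (2 ^ n)"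
proof -
  have "map2 (*) (map pauli_mat P) (map pauli_mat P) = replicate n (1\<^sub>m 2)"
    using assms by (auto simp: pauli_strings_def pauli_mat_sq intro!: nth_equalityI)
  then show ?thesis
    using tensor_list_mult[OF _ set_map_pauli_mat set_map_pauli_mat, of P P]
    by (simp add: pauli_string_mat_def tensor_list_replicate_one)
qed

text \<open>Hilbert-Schmidt orthogonality: the trace factors over the qubits, and a single position
  where the strings differ contributes a factor 0.\<close>

lemma trace_pauli_string_mult:
  assumes "P \<in> pauli_strings n" "Q \<in> pauli_strings n"
  shows "trace (pauli_string_mat P * pauli_string_mat Q) = (if P = Q then 2 ^ n else 0)"
proof -
  have len: "length P = n" "length Q = n" using assms by (auto simp: pauli_strings_def)
  have "trace (pauli_string_mat P * pauli_string_mat Q) = (\<Prod>q<n. if P ! q = Q ! q then 2 else 0)"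
    using len tensor_list_mult[OF _ set_map_pauli_mat set_map_pauli_mat, of P Q]
      trace_tensor_list[OF set_map2_mult_carrier[OF set_map_pauli_mat set_map_pauli_mat], of P Q]
    by (simp add: pauli_string_mat_def trace_pauli_mat_mult)
  also have "\<dots> = (if P = Q then 2 ^ n else 0)"
    using len by (auto simp: list_eq_iff_nth_eq)
  finally show ?thesis .
qed

lemma finite_pauli_strings [simp]: "finite (pauli_strings n)"
proof -
  have "(UNIV :: pauli set) = {PauliI, PauliX, PauliY, PauliZ}"
    using pauli.exhaust by auto
  then have "finite (UNIV :: pauli set)"
    by (metis finite.emptyI finite_insert)
  from finite_lists_length_eq[OF this, of n] show ?thesis
    by (simp add: pauli_strings_def)
qed

lemma sum_delta2:
  fixes f :: "'a \<Rightarrow> 'b \<Rightarrow> 'c::comm_monoid_add"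
  assumes "finite S" "finite T" "a \<in> S" "b \<in> T"
  shows "(\<Sum>x\<in>S. \<Sum>y\<in>T. if x = a \<and> y = b then f x y else 0) = f a b"
proof -
  have "(\<Sum>x\<in>S. \<Sum>y\<in>T. if x = a \<and> y = b then f x y else 0) =
      (\<Sum>x\<in>S. if x = a then f a b else 0)"
    using assms by (intro sum.cong refl) auto
  then show ?thesis using assms by simp
qed

text \<open>Applied to matrix units, two expansions of one map give a vanishing combination of
  products of an entry of \<open>P\<close> and an entry of \<open>Q\<close>. Pairing it with the
  entries of \<open>A\<close> and \<open>B\<close> produces traces, and orthogonality isolates the
  difference of the coefficients at \<open>A\<close>, \<open>B\<close>.\<close>

lemma chi_matrix_unique:
  assumes chi: "is_chi_matrix n K chi" and chi': "is_chi_matrix n K chi'"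
    and A: "A \<in> pauli_strings n" and B: "B \<in> pauli_strings n"
  shows "chi A B = chi' A B"
proof -
  let ?S = "pauli_strings n" and ?d = "2 ^ n :: nat" and ?m = pauli_string_mat
  define D where "D P Q = chi P Q - chi' P Q" for P Q
  \<comment> \<open>A matrix unit between \<open>P\<close> and \<open>Q\<close> selects one column
    of \<open>P\<close> and one row of \<open>Q\<close>.\<close>
  have entry: "(?m P * unit * ?m Q) $$ (i, j) = ?m P $$ (i, k) * ?m Q $$ (l, j)"
    if "P \<in> ?S" "Q \<in> ?S" "i < ?d" "j < ?d" "k < ?d" "l < ?d"
      and unit: "unit = mat ?d ?d (\<lambda>(x, y). if x = k \<and> y = l then 1 else 0)"
    for P Q i j k l unit
  proof -
    note car = pauli_string_mat_carrier[OF \<open>P \<in> ?S\<close>] pauli_string_mat_carrier[OF \<open>Q \<in> ?S\<close>]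
    have u: "unit \<in> carrier_mat ?d ?d" by (simp add: unit)
    have row: "(?m P * unit) $$ (i, y) = (if y = l then ?m P $$ (i, k) else 0)" if "y < ?d" for y
      unfolding index_mult_mat_sum[OF car(1) u \<open>i < ?d\<close> that]
      using \<open>k < ?d\<close> that by (simp add: unit if_distrib cong: if_cong)
    have Pu: "?m P * unit \<in> carrier_mat ?d ?d" using car u by auto
    have "(?m P * unit * ?m Q) $$ (i, j) =
        (\<Sum>y<?d. (if y = l then ?m P $$ (i, k) else 0) * ?m Q $$ (y, j))"
      unfolding index_mult_mat_sum[OF Pu car(2) \<open>i < ?d\<close> \<open>j < ?d\<close>]
      by (intro sum.cong) (auto simp: row simp del: index_mult_mat)
    then show ?thesis using \<open>l < ?d\<close> by (simp add: if_distrib if_distribR cong: if_cong)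
  qed
  have zero: "(\<Sum>P\<in>?S. \<Sum>Q\<in>?S. D P Q * (?m P $$ (i, k) * ?m Q $$ (l, j))) = 0"
    if "i < ?d" "j < ?d" "k < ?d" "l < ?d" for i j k l
  proof -
    define unit :: "complex mat" where
      "unit = mat ?d ?d (\<lambda>(x, y). if x = k \<and> y = l then 1 else 0)"
    have u: "unit \<in> carrier_mat ?d ?d" by (simp add: unit_def)
    have *: "K unit $$ (i, j) = (\<Sum>P\<in>?S. \<Sum>Q\<in>?S. c P Q * (?m P $$ (i, k) * ?m Q $$ (l, j)))"
      if "is_chi_matrix n K c" for c
    proof -
      have "K unit $$ (i, j) = (\<Sum>P\<in>?S. \<Sum>Q\<in>?S. c P Q * (?m P * unit * ?m Q) $$ (i, j))"
        using that u \<open>i < ?d\<close> \<open>j < ?d\<close> by (auto simp: is_chi_matrix_def)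
      also have "\<dots> = (\<Sum>P\<in>?S. \<Sum>Q\<in>?S. c P Q * (?m P $$ (i, k) * ?m Q $$ (l, j)))"
        by (intro sum.cong refl) (simp only: entry[OF _ _ \<open>i < ?d\<close> \<open>j < ?d\<close> \<open>k < ?d\<close> \<open>l < ?d\<close> unit_def])
      finally show ?thesis .
    qed
    show ?thesis
      using *[OF chi] *[OF chi'] by (simp add: D_def left_diff_distrib sum_subtractf)
  qed
  \<comment> \<open>The transposed index pairs \<open>(k, i)\<close> and \<open>(j, l)\<close> are
    chosen so that the four index sums close up into the traces of \<open>A P\<close> and
    \<open>B Q\<close> once the sums over strings are moved outside.\<close>
  have "(\<Sum>k<?d. \<Sum>i<?d. \<Sum>j<?d. \<Sum>l<?d. ?m A $$ (k, i) * ?m B $$ (j, l) *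
      (\<Sum>P\<in>?S. \<Sum>Q\<in>?S. D P Q * (?m P $$ (i, k) * ?m Q $$ (l, j)))) = 0"
    by (simp add: zero)
  also have "(\<Sum>k<?d. \<Sum>i<?d. \<Sum>j<?d. \<Sum>l<?d. ?m A $$ (k, i) * ?m B $$ (j, l) *
      (\<Sum>P\<in>?S. \<Sum>Q\<in>?S. D P Q * (?m P $$ (i, k) * ?m Q $$ (l, j)))) =
    (\<Sum>k<?d. \<Sum>i<?d. \<Sum>j<?d. \<Sum>l<?d. \<Sum>P\<in>?S. \<Sum>Q\<in>?S. D P Q *
      ((?m A $$ (k, i) * ?m P $$ (i, k)) * (?m B $$ (j, l) * ?m Q $$ (l, j))))"
    by (simp add: sum_distrib_left mult_ac)
  also have "\<dots> = (\<Sum>P\<in>?S. \<Sum>Q\<in>?S. \<Sum>k<?d. \<Sum>i<?d. \<Sum>j<?d. \<Sum>l<?d. D P Q *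
      ((?m A $$ (k, i) * ?m P $$ (i, k)) * (?m B $$ (j, l) * ?m Q $$ (l, j))))"
    by (simp only: sum.swap[where A = "{..<?d}" and B = ?S])
  also have "\<dots> = (\<Sum>P\<in>?S. \<Sum>Q\<in>?S. D P Q * (trace (?m A * ?m P) * trace (?m B * ?m Q)))"
    by (intro sum.cong refl)
      (simp only: trace_mult[OF pauli_string_mat_carrier[OF A] pauli_string_mat_carrier]
        trace_mult[OF pauli_string_mat_carrier[OF B] pauli_string_mat_carrier]
        sum_distrib_left[symmetric] sum_distrib_right[symmetric])
  also have "\<dots> = (\<Sum>P\<in>?S. \<Sum>Q\<in>?S. if P = A \<and> Q = B then D P Q * (2 ^ n * 2 ^ n) else 0)"
    by (intro sum.cong refl) (auto simp: trace_pauli_string_mult[of _ n] A B)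
  also have "\<dots> = D A B * (2 ^ n * 2 ^ n)"
    using A B by (simp add: sum_delta2)
  finally show ?thesis by (simp add: D_def)
qed

section \<open>Hamiltonian evolution\<close>

text \<open>The commutator is the sum of one sandwich with \<open>R\<close> on the left and one with
  \<open>R\<close> on the right. The coefficients are a sum of two indicators rather than a case
  split, so that they cancel correctly if \<open>R\<close> is the identity string.\<close>

lemma is_chi_matrix_hamiltonian:
  assumes R: "R \<in> pauli_strings n"
  shows "is_chi_matrix n (hamiltonian_generator R \<theta>)
    (\<lambda>P Q. (if P = R \<and> Q = pauli_id n then - \<i> * \<theta> else 0) +
           (if P = pauli_id n \<and> Q = R then \<i> * \<theta> else 0))"
  unfolding is_chi_matrix_def
proof (intro ballI allI impI)
  fix M :: "complex mat" and i j :: nat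
  assume M: "M \<in> carrier_mat (2 ^ n) (2 ^ n)" and ij: "i < 2 ^ n" "j < 2 ^ n"
  let ?m = pauli_string_mat and ?I = "pauli_id n"
  have I: "?I \<in> pauli_strings n" by (simp add: pauli_id_def pauli_strings_def)
  note Rc = pauli_string_mat_carrier[OF R]
  define A where "A = ?m R * M"
  define B where "B = M * ?m R"
  have AB: "A \<in> carrier_mat (2 ^ n) (2 ^ n)" "B \<in> carrier_mat (2 ^ n) (2 ^ n)"
    unfolding A_def B_def using M Rc by auto
  have gen: "hamiltonian_generator R \<theta> M = (- \<i>) \<cdot>\<^sub>m (of_real \<theta> \<cdot>\<^sub>m A - of_real \<theta> \<cdot>\<^sub>m B)"
    unfolding hamiltonian_generator_def Let_def A_def B_def
    using M Rc by (simp add: mult_smult_distrib mult_smult_assoc_mat)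
  have RI: "?m R * M * ?m ?I = A" "?m ?I * M * ?m R = B"
    using AB(1) M unfolding A_def B_def pauli_string_mat_id by auto
  have if_add: "(if p then a * z else 0) + (if q then b * z else 0) =
      ((if p then a else 0) + (if q then b else 0)) * z" for p q and a b z :: complex
    by (cases p; cases q; simp add: distrib_right)
  let ?X = "\<lambda>P Q. (?m P * M * ?m Q) $$ (i, j)"
  have "hamiltonian_generator R \<theta> M $$ (i, j) = - \<i> * \<theta> * A $$ (i, j) + \<i> * \<theta> * B $$ (i, j)"
    unfolding gen using AB ij by (simp add: algebra_simps)
  also have "\<dots> = (\<Sum>P\<in>pauli_strings n. \<Sum>Q\<in>pauli_strings n.
      (if P = R \<and> Q = ?I then - \<i> * \<theta> * ?X P Q else 0) +
      (if P = ?I \<and> Q = R then \<i> * \<theta> * ?X P Q else 0))"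
    unfolding sum.distrib
      sum_delta2[OF finite_pauli_strings finite_pauli_strings R I, of "\<lambda>P Q. - \<i> * \<theta> * ?X P Q"]
      sum_delta2[OF finite_pauli_strings finite_pauli_strings I R, of "\<lambda>P Q. \<i> * \<theta> * ?X P Q"]
    by (simp only: RI)
  also have "\<dots> = (\<Sum>P\<in>pauli_strings n. \<Sum>Q\<in>pauli_strings n.
      ((if P = R \<and> Q = ?I then - \<i> * \<theta> else 0) +
       (if P = ?I \<and> Q = R then \<i> * \<theta> else 0)) * ?X P Q)"
    by (simp only: if_add)
  finally show "hamiltonian_generator R \<theta> M $$ (i, j) = (\<Sum>P\<in>pauli_strings n. \<Sum>Q\<in>pauli_strings n.
      ((if P = R \<and> Q = ?I then - \<i> * \<theta> else 0) +
       (if P = ?I \<and> Q = R then \<i> * \<theta> else 0)) * ?X P Q)" .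
qed

text \<open>To evaluate the definite description, the explicit coefficients must be its only
  solution: on strings of length \<open>n\<close> this is uniqueness of the expansion, elsewhere
  both functions are 0. As \<open>R\<close> is not the identity string, only the first indicator
  fires at \<open>R\<close>, \<open>pauli_id n\<close>.\<close>

lemma chi_matrix_hamiltonian:
  assumes R: "R \<in> pauli_strings n" "R \<noteq> pauli_id n"
  shows "chi_matrix n (hamiltonian_generator R \<theta>) R (pauli_id n) = - \<i> * \<theta>"
proof -
  define chi where "chi P Q = (if P = R \<and> Q = pauli_id n then - \<i> * \<theta> else 0) +
           (if P = pauli_id n \<and> Q = R then \<i> * \<theta> else 0)" for P Q
  have is_chi: "is_chi_matrix n (hamiltonian_generator R \<theta>) chi"
    using is_chi_matrix_hamiltonian[OF R(1)] by (simp add: chi_def[abs_def])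
  have I: "pauli_id n \<in> pauli_strings n" by (simp add: pauli_id_def pauli_strings_def)
  have outside: "\<forall>P Q. P \<notin> pauli_strings n \<or> Q \<notin> pauli_strings n \<longrightarrow> chi P Q = 0"
    using R I by (auto simp: chi_def)
  have "chi_matrix n (hamiltonian_generator R \<theta>) = chi"
    unfolding chi_matrix_def
  proof (rule the_equality, use is_chi outside in blast, intro ext)
    fix chi' P Q
    assume "is_chi_matrix n (hamiltonian_generator R \<theta>) chi' \<and>
      (\<forall>P Q. P \<notin> pauli_strings n \<or> Q \<notin> pauli_strings n \<longrightarrow> chi' P Q = 0)"
    then show "chi' P Q = chi P Q"
      using chi_matrix_unique[OF _ is_chi] outside by metis
  qed
  then show ?thesis using R by (simp add: chi_def)
qed

text \<open>For an involution \<open>R\<close>, the span of \<open>M\<close>, \<open>R M R\<close>,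
  \<open>R M\<close> and \<open>M R\<close> is closed under multiplication by \<open>R\<close> from
  either side, hence under the generator. Tracking four scalars then replaces iterating a
  superoperator.\<close>

definition sandwich_comb ::
  "complex mat \<Rightarrow> complex mat \<Rightarrow> complex \<Rightarrow> complex \<Rightarrow> complex \<Rightarrow> complex \<Rightarrow> complex mat" where
  "sandwich_comb R M x y p q = x \<cdot>\<^sub>m M + y \<cdot>\<^sub>m (R * M * R) + p \<cdot>\<^sub>m (R * M) + q \<cdot>\<^sub>m (M * R)"

lemma sandwich_comb_carrier:
  assumes "R \<in> carrier_mat d d" "M \<in> carrier_mat d d"
  shows "sandwich_comb R M x y p q \<in> carrier_mat d d"
  using assms by (auto simp: sandwich_comb_def)

lemma sandwich_comb_index:
  assumes "R \<in> carrier_mat d d" "M \<in> carrier_mat d d" "i < d" "j < d"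
  shows "sandwich_comb R M x y p q $$ (i, j) =
    x * M $$ (i, j) + y * (R * M * R) $$ (i, j) + p * (R * M) $$ (i, j) + q * (M * R) $$ (i, j)"
  using assms by (simp add: sandwich_comb_def del: index_mult_mat(1))

text \<open>Since \<open>R\<close> squares to the identity, left multiplication swaps
  \<open>M\<close> with \<open>R M\<close> and \<open>R M R\<close> with \<open>M R\<close>, while
  right multiplication swaps \<open>M\<close> with \<open>M R\<close> and \<open>R M R\<close> with
  \<open>R M\<close>.\<close>

lemma sandwich_comb_mult:
  assumes R: "R \<in> carrier_mat d d" and M: "M \<in> carrier_mat d d" and sq: "R * R = 1\<^sub>m d"
  shows "R * sandwich_comb R M x y p q = sandwich_comb R M p q x y"
    and "sandwich_comb R M x y p q * R = sandwich_comb R M q p y x"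
proof -
  have RM: "R * M \<in> carrier_mat d d" and MR: "M * R \<in> carrier_mat d d"
    and RMR: "R * M * R \<in> carrier_mat d d"
    using R M by auto
  have 1: "R * (R * M) = M"
    using assoc_mult_mat[OF R R M] M by (simp add: sq)
  have 2: "R * (R * M * R) = M * R"
    using assoc_mult_mat[OF R RM R] 1 by simp
  have 3: "M * R * R = M"
    using assoc_mult_mat[OF M R R] M by (simp add: sq)
  have 4: "R * M * R * R = R * M"
    using assoc_mult_mat[OF RM R R] right_mult_one_mat[OF RM] by (simp add: sq)
  have 5: "R * (M * R) = R * M * R"
    using assoc_mult_mat[OF R M R] by simp
  note dims = carrier_matD[OF M] carrier_matD[OF RM] carrier_matD[OF MR] carrier_matD[OF RMR]
  have "R * sandwich_comb R M x y p q =
      x \<cdot>\<^sub>m (R * M) + y \<cdot>\<^sub>m (M * R) + p \<cdot>\<^sub>m M + q \<cdot>\<^sub>m (R * M * R)"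
    unfolding sandwich_comb_def
    using R M RM MR RMR
    by (simp add: mult_add_distrib_mat[of _ d d _ d] mult_smult_distrib[of _ d d _ d] 1 2 5
        del: assoc_mult_mat)
  also have "\<dots> = sandwich_comb R M p q x y"
    unfolding sandwich_comb_def by (intro eq_matI) (simp_all only: dims index_add_mat index_smult_mat algebra_simps)
  finally show "R * sandwich_comb R M x y p q = sandwich_comb R M p q x y" .
  have "sandwich_comb R M x y p q * R =
      x \<cdot>\<^sub>m (M * R) + y \<cdot>\<^sub>m (R * M) + p \<cdot>\<^sub>m (R * M * R) + q \<cdot>\<^sub>m M"
    unfolding sandwich_comb_def
    using R M RM MR RMR
    by (simp add: add_mult_distrib_mat[of _ d d _ _ d] mult_smult_assoc_mat[of _ d d _ d] 3 4
        del: assoc_mult_mat)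
  also have "\<dots> = sandwich_comb R M q p y x"
    unfolding sandwich_comb_def by (intro eq_matI) (simp_all only: dims index_add_mat index_smult_mat algebra_simps)
  finally show "sandwich_comb R M x y p q * R = sandwich_comb R M q p y x" .
qed

lemma hamiltonian_generator_sandwich_comb:
  fixes \<theta> :: real
  assumes R: "R \<in> pauli_strings n" and M: "M \<in> carrier_mat (2 ^ n) (2 ^ n)"
  defines "F \<equiv> sandwich_comb (pauli_string_mat R) M" and "\<mu> \<equiv> - \<i> * \<theta>"
  shows "hamiltonian_generator R \<theta> (F x y p q) =
    F (\<mu> * (p - q)) (\<mu> * (q - p)) (\<mu> * (x - y)) (\<mu> * (y - x))"
proof -
  note Rc = pauli_string_mat_carrier[OF R]
  note car = sandwich_comb_carrier[OF Rc M, folded F_def]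
  note mult = sandwich_comb_mult[OF Rc M pauli_string_mat_sq[OF R], folded F_def]
  note dims = carrier_matD[OF car]
  have "hamiltonian_generator R \<theta> (F x y p q) =
      (- \<i>) \<cdot>\<^sub>m (of_real \<theta> \<cdot>\<^sub>m F p q x y - of_real \<theta> \<cdot>\<^sub>m F q p y x)"
    unfolding hamiltonian_generator_def Let_def
    using Rc car
    by (simp add: mult_smult_distrib[of _ "2 ^ n" "2 ^ n" _ "2 ^ n"]
        mult_smult_assoc_mat[of _ "2 ^ n" "2 ^ n" _ "2 ^ n"] mult)
  also have "\<dots> = F (\<mu> * (p - q)) (\<mu> * (q - p)) (\<mu> * (x - y)) (\<mu> * (y - x))"
  proof (rule eq_matI)
    fix i j
    assume "i < dim_row (F (\<mu> * (p - q)) (\<mu> * (q - p)) (\<mu> * (x - y)) (\<mu> * (y - x)))"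
      "j < dim_col (F (\<mu> * (p - q)) (\<mu> * (q - p)) (\<mu> * (x - y)) (\<mu> * (y - x)))"
    then have ij: "i < 2 ^ n" "j < 2 ^ n" by (auto simp: dims)
    show "((- \<i>) \<cdot>\<^sub>m (of_real \<theta> \<cdot>\<^sub>m F p q x y - of_real \<theta> \<cdot>\<^sub>m F q p y x)) $$ (i, j) =
        F (\<mu> * (p - q)) (\<mu> * (q - p)) (\<mu> * (x - y)) (\<mu> * (y - x)) $$ (i, j)"
      using ij dims
      by (simp add: sandwich_comb_index[OF Rc M ij, folded F_def] \<mu>_def algebra_simps
          del: index_mult_mat(1))
  qed (simp_all add: dims)
  finally show ?thesis .
qed

text \<open>The matrices \<open>M - R M R \<plusminus> (R M - M R)\<close> are eigenvectors of the generator with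
  eigenvalues \<open>\<minusplus>2\<i>\<theta>\<close>, and \<open>M + R M R\<close> lies in its kernel.\<close>

lemma hamiltonian_generator_funpow:
  fixes \<theta> :: real
  assumes R: "R \<in> pauli_strings n" and M: "M \<in> carrier_mat (2 ^ n) (2 ^ n)"
  defines "F \<equiv> sandwich_comb (pauli_string_mat R) M" and "\<mu> \<equiv> - 2 * \<i> * \<theta>"
  shows "(hamiltonian_generator R \<theta> ^^ m) M =
    F (0 ^ m / 2 + (\<mu> ^ m + (- \<mu>) ^ m) / 4) (0 ^ m / 2 - (\<mu> ^ m + (- \<mu>) ^ m) / 4)
      ((\<mu> ^ m - (- \<mu>) ^ m) / 4) (- (\<mu> ^ m - (- \<mu>) ^ m) / 4)"
proof (induction m)
  \<comment> \<open>Here \<open>0 ^ 0 = 1\<close> matters: the component in the kernel contributes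
    to the zeroth power and to no later one.\<close>
  case 0
  note Rc = pauli_string_mat_carrier[OF R]
  have "M = F 1 0 0 0"
    unfolding F_def using sandwich_comb_carrier[OF Rc M, of 1 0 0 0] M
    by (intro eq_matI) (auto simp: sandwich_comb_index[OF Rc M] simp del: index_mult_mat(1))
  then show ?case by simp
next
  case (Suc m)
  have cong: "sandwich_comb (pauli_string_mat R) M x y p q = sandwich_comb (pauli_string_mat R) M x' y' p' q'"
    if "x = x'" "y = y'" "p = p'" "q = q'" for x y p q x' y' p' q'
    using that by simp
  show ?case
    unfolding funpow.simps o_apply Suc
    unfolding F_def hamiltonian_generator_sandwich_comb[OF R M]
    by (rule cong) (simp_all add: \<mu>_def field_simps)
qed

section \<open>Summation of the exponential series\<close>

lemma exp_sums_of_real: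
  fixes z :: complex
  shows "(\<lambda>m. of_real (t ^ m / fact m) * z ^ m) sums exp (of_real t * z)"
proof -
  have "(\<lambda>m. (of_real t * z) ^ m /\<^sub>R fact m) = (\<lambda>m. of_real (t ^ m / fact m) * z ^ m)"
    by (intro ext) (simp add: scaleR_conv_of_real power_mult_distrib field_simps)
  then show ?thesis using exp_converges[of "of_real t * z"] by simp
qed

text \<open>This is conjugation of \<open>M\<close> by the unitary \<open>c I - \<i> s R\<close>,
  multiplied out. It is obtained by summing the entrywise series separately for the eigenvalues 0,
  \<open>\<mu>\<close> and \<open>- \<mu>\<close>.\<close>

lemma superop_exp_hamiltonian:
  fixes \<theta> t :: real
  assumes R: "R \<in> pauli_strings n" and M: "M \<in> carrier_mat (2 ^ n) (2 ^ n)"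
  defines "c \<equiv> complex_of_real (cos (\<theta> * t))" and "s \<equiv> complex_of_real (sin (\<theta> * t))"
  shows "superop_exp (2 ^ n) t (hamiltonian_generator R \<theta>) M =
    sandwich_comb (pauli_string_mat R) M (c\<^sup>2) (s\<^sup>2) (- \<i> * s * c) (\<i> * s * c)" (is "?L = ?R")
proof (rule eq_matI)
  note Rc = pauli_string_mat_carrier[OF R]
  note car = sandwich_comb_carrier[OF Rc M]
  fix i j assume "i < dim_row ?R" "j < dim_col ?R"
  then have ij: "i < 2 ^ n" "j < 2 ^ n" using car by (metis carrier_matD)+
  have cs: "s\<^sup>2 = 1 - c\<^sup>2"
    unfolding c_def s_def by (simp flip: of_real_power add: sin_squared_eq)
  define \<mu> where "\<mu> = - 2 * \<i> * \<theta>"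
  define m0 where "m0 = M $$ (i, j)"
  define m1 where "m1 = (pauli_string_mat R * M * pauli_string_mat R) $$ (i, j)"
  define m2 where "m2 = (pauli_string_mat R * M) $$ (i, j)"
  define m3 where "m3 = (M * pauli_string_mat R) $$ (i, j)"
  define e where "e z m = of_real (t ^ m / fact m) * z ^ m" for z :: complex and m
  \<comment> \<open>Grouping each entry by eigenvalue makes it a fixed combination of three scalar
    exponential series.\<close>
  have "of_real (t ^ m / fact m) * (hamiltonian_generator R \<theta> ^^ m) M $$ (i, j) =
      e 0 m * ((m0 + m1) / 2) + e \<mu> m * ((m0 - m1 + m2 - m3) / 4) +
      e (- \<mu>) m * ((m0 - m1 - m2 + m3) / 4)" for m
  proof -
    have *: "k * ((z / 2 + (a + b) / 4) * m0 + (z / 2 - (a + b) / 4) * m1 + (a - b) / 4 * m2 +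
        - (a - b) / 4 * m3) =
      k * z * ((m0 + m1) / 2) + k * a * ((m0 - m1 + m2 - m3) / 4) + k * b * ((m0 - m1 - m2 + m3) / 4)"
      for k z a b :: complex
      by (simp add: field_simps)
    show ?thesis
      unfolding hamiltonian_generator_funpow[OF R M] sandwich_comb_index[OF Rc M ij]
      unfolding e_def \<mu>_def[symmetric] m0_def[symmetric] m1_def[symmetric] m2_def[symmetric]
        m3_def[symmetric]
      by (rule *)
  qed
  moreover have "(\<lambda>m. e 0 m * ((m0 + m1) / 2) + e \<mu> m * ((m0 - m1 + m2 - m3) / 4) +
      e (- \<mu>) m * ((m0 - m1 - m2 + m3) / 4)) sums
      (exp (of_real t * 0) * ((m0 + m1) / 2) + exp (of_real t * \<mu>) * ((m0 - m1 + m2 - m3) / 4) +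
      exp (of_real t * - \<mu>) * ((m0 - m1 - m2 + m3) / 4))"
    unfolding e_def by (intro sums_add sums_mult2 exp_sums_of_real)
  ultimately have entry: "?L $$ (i, j) =
      (m0 + m1) / 2 + exp (of_real t * \<mu>) * ((m0 - m1 + m2 - m3) / 4) +
      exp (of_real t * - \<mu>) * ((m0 - m1 - m2 + m3) / 4)"
    using ij by (simp add: superop_exp_def sums_iff)
  \<comment> \<open>The exponents are twice the angle, so these are the squares of
    \<open>c - \<i> s\<close> and \<open>c + \<i> s\<close>, with the square of \<open>s\<close>
    eliminated to leave polynomials in \<open>c\<close> and the product \<open>s c\<close>.\<close>
  have exp: "exp (of_real t * \<mu>) = 2 * c\<^sup>2 - 1 - 2 * \<i> * s * c"
    "exp (of_real t * - \<mu>) = 2 * c\<^sup>2 - 1 + 2 * \<i> * s * c"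
  proof -
    have "of_real t * \<mu> = 2 * (\<i> * of_real (- (\<theta> * t)))" "of_real t * - \<mu> = 2 * (\<i> * of_real (\<theta> * t))"
      by (simp_all add: \<mu>_def)
    then have "exp (of_real t * \<mu>) = (cis (- (\<theta> * t)))\<^sup>2" "exp (of_real t * - \<mu>) = (cis (\<theta> * t))\<^sup>2"
      by (simp_all only: exp_double cis_conv_exp)
    moreover have "cis (\<theta> * t) = c + \<i> * s" "cis (- (\<theta> * t)) = c - \<i> * s"
      by (simp_all add: complex_eq_iff c_def s_def)
    ultimately show "exp (of_real t * \<mu>) = 2 * c\<^sup>2 - 1 - 2 * \<i> * s * c"
        "exp (of_real t * - \<mu>) = 2 * c\<^sup>2 - 1 + 2 * \<i> * s * c"
      by (simp_all add: power2_diff power2_sum power_mult_distrib cs)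
  qed
  have "?L $$ (i, j) = c\<^sup>2 * m0 + s\<^sup>2 * m1 + (- \<i> * s * c) * m2 + (\<i> * s * c) * m3"
  proof -
    have *: "(m0 + m1) / 2 + (2 * C - 1 - 2 * k) * ((m0 - m1 + m2 - m3) / 4) +
        (2 * C - 1 + 2 * k) * ((m0 - m1 - m2 + m3) / 4) =
      C * m0 + (1 - C) * m1 + (- k) * m2 + k * m3" for C k :: complex
      by (simp add: field_simps)
    show ?thesis
      using *[of "c\<^sup>2" "\<i> * s * c"] unfolding entry exp cs by (simp add: mult.assoc)
  qed
  then show "?L $$ (i, j) = ?R $$ (i, j)"
    unfolding sandwich_comb_index[OF Rc M ij] m0_def m1_def m2_def m3_def .
qed (simp_all only: superop_exp_def dim_row_mat dim_col_mat
    carrier_matD[OF sandwich_comb_carrier[OF pauli_string_mat_carrier[OF R] M]])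

section \<open>One qubit\<close>

text \<open>Hermiticity and unit trace leave three real parameters, and positivity makes the
  determinant nonnegative. With these parameters, the one-qubit claims become polynomial
  (in)equalities.\<close>

lemma density_matrix_2_entries:
  assumes "density_matrix 2 \<rho>"
  obtains a x y :: real where
    "\<rho> \<in> carrier_mat 2 2" "0 \<le> a" "a \<le> 1" "x\<^sup>2 + y\<^sup>2 \<le> a - a\<^sup>2"
    "\<rho> $$ (0, 0) = of_real a" "\<rho> $$ (1, 1) = of_real (1 - a)"
    "\<rho> $$ (0, 1) = Complex x y" "\<rho> $$ (1, 0) = Complex x (- y)"
proof -
  have car: "\<rho> \<in> carrier_mat 2 2" and adj: "mat_adjoint \<rho> = \<rho>"
    and pos: "\<And>v. v \<in> carrier_vec 2 \<Longrightarrow> Re ((\<rho> *\<^sub>v v) \<bullet>c v) \<ge> 0" and tr: "trace \<rho> = 1"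
    using assms by (auto simp: density_matrix_def)
  have herm: "\<rho> $$ (i, j) = cnj (\<rho> $$ (j, i))" if "i < 2" "j < 2" for i j
  proof -
    have "mat_adjoint \<rho> $$ (i, j) = cnj (\<rho> $$ (j, i))"
      using car that by (simp add: mat_adjoint_def mat_of_rows_index)
    then show ?thesis by (simp add: adj)
  qed
  define a where "a = Re (\<rho> $$ (0, 0))"
  define d where "d = Re (\<rho> $$ (1, 1))"
  define x where "x = Re (\<rho> $$ (0, 1))"
  define y where "y = Im (\<rho> $$ (0, 1))"
  have e: "\<rho> $$ (0, 0) = of_real a" "\<rho> $$ (1, 1) = of_real d"
      "\<rho> $$ (0, 1) = Complex x y" "\<rho> $$ (1, 0) = Complex x (- y)"
    using herm[of 0 0] herm[of 1 1] herm[of 1 0]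
    by (auto simp: a_def d_def x_def y_def complex_eq_iff)
  have "a + d = 1"
    using tr car by (simp add: trace_def lessThan_two a_def d_def complex_eq_iff)
  have quad: "a * ((Re p)\<^sup>2 + (Im p)\<^sup>2) + d * ((Re q)\<^sup>2 + (Im q)\<^sup>2) + 2 * Re (Complex x y * q * cnj p) \<ge> 0" for p q
  proof -
    define v where "v = vec 2 (\<lambda>i. if i = 0 then p else q)"
    have v: "v \<in> carrier_vec 2" "v $ 0 = p" "v $ 1 = q" by (auto simp: v_def)
    have "(\<rho> *\<^sub>v v) \<bullet>c v =
        (\<rho> $$ (0, 0) * p + \<rho> $$ (0, 1) * q) * cnj p + (\<rho> $$ (1, 0) * p + \<rho> $$ (1, 1) * q) * cnj q"
      using car v by (simp add: scalar_prod_def numeral_2_eq_2)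
    also have "Re \<dots> = a * ((Re p)\<^sup>2 + (Im p)\<^sup>2) + d * ((Re q)\<^sup>2 + (Im q)\<^sup>2) + 2 * Re (Complex x y * q * cnj p)"
      unfolding e by (simp add: power2_eq_square algebra_simps)
    finally show ?thesis using pos[OF v(1)] by simp
  qed
  have a: "a \<ge> 0" using quad[of 1 0] by simp
  have d: "d \<ge> 0" using quad[of 0 1] by simp
  \<comment> \<open>The two test vectors are chosen so that the quadratic form equals the
    determinant times \<open>a\<close>, respectively times \<open>d\<close>. Adding the results and
    using \<open>a + d = 1\<close> avoids dividing by a diagonal entry, which may be 0.\<close>
  have "a * (a * d - (x\<^sup>2 + y\<^sup>2)) \<ge> 0"
    using quad[of "- Complex x y" "of_real a"]
    by (simp add: power2_eq_square algebra_simps)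
  moreover have "d * (a * d - (x\<^sup>2 + y\<^sup>2)) \<ge> 0"
    using quad[of "of_real d" "- Complex x (- y)"]
    by (simp add: power2_eq_square algebra_simps)
  ultimately have "(a + d) * (a * d - (x\<^sup>2 + y\<^sup>2)) \<ge> 0"
    by (simp add: distrib_right)
  then have "x\<^sup>2 + y\<^sup>2 \<le> a * d" by (simp add: \<open>a + d = 1\<close>)
  moreover have d': "d = 1 - a" using \<open>a + d = 1\<close> by simp
  ultimately have "x\<^sup>2 + y\<^sup>2 \<le> a - a\<^sup>2" by (simp add: power2_eq_square algebra_simps)
  moreover have "a \<le> 1" using d d' by simp
  ultimately show ?thesis
    using that[OF car a, of x y] e unfolding d' by blast
qed

lemma pauli_projector_carrier [simp]: "pauli_projector P b \<in> carrier_mat 2 2"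
  by (simp add: pauli_projector_def)

lemma pauli_projector_index:
  assumes "i < 2" "j < 2"
  shows "pauli_projector P b $$ (i, j) =
    (if i = j then 1 / 2 else 0) + (if b then 1 / 2 else - 1 / 2) * pauli_mat P $$ (i, j)"
  using assms carrier_matD[OF pauli_mat_carrier[of P]] by (auto simp: pauli_projector_def algebra_simps)

lemma trace_pauli_projector_mult:
  assumes "A \<in> carrier_mat 2 2"
  shows "trace (pauli_projector P b * A) = (let s = (if b then 1 else - 1) in case P of
      PauliI \<Rightarrow> (1 + s) * (A $$ (0, 0) + A $$ (1, 1))
    | PauliX \<Rightarrow> A $$ (0, 0) + A $$ (1, 1) + s * (A $$ (0, 1) + A $$ (1, 0))
    | PauliY \<Rightarrow> A $$ (0, 0) + A $$ (1, 1) + s * \<i> * (A $$ (0, 1) - A $$ (1, 0))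
    | PauliZ \<Rightarrow> A $$ (0, 0) + A $$ (1, 1) + s * (A $$ (0, 0) - A $$ (1, 1))) / 2"
  by (cases P; cases b)
    (simp_all add: trace_mult[OF pauli_projector_carrier assms] lessThan_two pauli_projector_index
      algebra_simps add_divide_distrib diff_divide_distrib del: pauli_mat.simps index_mult_mat)

lemma pauli_mat_mult_index:
  assumes "A \<in> carrier_mat 2 2" "j < 2"
  shows "(pauli_mat R * A) $$ (0, j) = (case R of
      PauliI \<Rightarrow> A $$ (0, j) | PauliX \<Rightarrow> A $$ (1, j) | PauliY \<Rightarrow> - \<i> * A $$ (1, j) | PauliZ \<Rightarrow> A $$ (0, j))"
    "(pauli_mat R * A) $$ (Suc 0, j) = (case R of
      PauliI \<Rightarrow> A $$ (1, j) | PauliX \<Rightarrow> A $$ (0, j) | PauliY \<Rightarrow> \<i> * A $$ (0, j) | PauliZ \<Rightarrow> - A $$ (1, j))"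
    "(A * pauli_mat R) $$ (j, 0) = (case R of
      PauliI \<Rightarrow> A $$ (j, 0) | PauliX \<Rightarrow> A $$ (j, 1) | PauliY \<Rightarrow> \<i> * A $$ (j, 1) | PauliZ \<Rightarrow> A $$ (j, 0))"
    "(A * pauli_mat R) $$ (j, Suc 0) = (case R of
      PauliI \<Rightarrow> A $$ (j, 1) | PauliX \<Rightarrow> A $$ (j, 0) | PauliY \<Rightarrow> - \<i> * A $$ (j, 0) | PauliZ \<Rightarrow> - A $$ (j, 1))"
  using assms
  by (cases R; simp add: mult_mat2_index[OF pauli_mat_carrier] mult_mat2_index[OF _ pauli_mat_carrier]
      del: pauli_mat.simps index_mult_mat)+

text \<open>Here \<open>u\<close> and \<open>v\<close> are the outcome probabilities for the state
  and for its conjugate by \<open>R\<close>, and \<open>w\<close> is their interference term. The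
  bound on \<open>w\<close> is Cauchy-Schwarz for the state's form restricted by the projector; for
  each choice of Paulis it reduces to the determinant condition. The values of \<open>w\<close> sum
  to the trace of \<open>\<rho> R\<close>, which is real because both matrices are
  Hermitian.\<close>

lemma qubit_shot_statistics:
  fixes R P :: pauli
  assumes \<rho>: "density_matrix 2 \<rho>" and P: "P \<noteq> PauliI"
  defines "u \<equiv> \<lambda>b. trace (pauli_projector P b * \<rho>)"
    and "v \<equiv> \<lambda>b. trace (pauli_projector P b * (pauli_mat R * \<rho> * pauli_mat R))"
    and "w \<equiv> \<lambda>b. trace (pauli_projector P b * (\<rho> * pauli_mat R))"
    and "w' \<equiv> \<lambda>b. trace (pauli_projector P b * (pauli_mat R * \<rho>))"
  shows "u b = of_real (Re (u b))" "v b = of_real (Re (v b))" "w' b = cnj (w b)"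
    "Re (u b) \<ge> 0" "Re (v b) \<ge> 0" "(cmod (w b))\<^sup>2 \<le> Re (u b) * Re (v b)"
    "u True + u False = 1" "v True + v False = 1" "Im (w True + w False) = 0"
proof -
  obtain a x y :: real where car: "\<rho> \<in> carrier_mat 2 2"
    and a: "0 \<le> a" "a \<le> 1" and xy: "x\<^sup>2 + y\<^sup>2 \<le> a - a\<^sup>2"
    and e: "\<rho> $$ (0, 0) = of_real a" "\<rho> $$ (1, 1) = of_real (1 - a)"
    "\<rho> $$ (0, 1) = Complex x y" "\<rho> $$ (1, 0) = Complex x (- y)"
    by (rule density_matrix_2_entries[OF \<rho>])
  \<comment> \<open>Completing the square bounds both parts of the off-diagonal entry by 1/2, which
    makes the outcome probabilities of \<open>X\<close> and \<open>Y\<close> measurements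
    nonnegative.\<close>
  have "a - a\<^sup>2 = 1 / 4 - (a - 1 / 2)\<^sup>2" by (simp add: power2_eq_square field_simps)
  then have "a - a\<^sup>2 \<le> (1 / 2)\<^sup>2" by (simp add: power2_eq_square)
  with xy have "x\<^sup>2 \<le> (1 / 2)\<^sup>2" "y\<^sup>2 \<le> (1 / 2)\<^sup>2"
    using zero_le_power2[of x] zero_le_power2[of y] by linarith+
  then have x: "- 1 / 2 \<le> x" "x \<le> 1 / 2" and y: "- 1 / 2 \<le> y" "y \<le> 1 / 2"
    by (auto simp: abs_le_square_iff[symmetric])
  have car': "pauli_mat R * \<rho> \<in> carrier_mat 2 2" "\<rho> * pauli_mat R \<in> carrier_mat 2 2"
      "pauli_mat R * \<rho> * pauli_mat R \<in> carrier_mat 2 2" for R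
    using car by (auto intro!: mult_carrier_mat[of _ 2 2])
  note traces = trace_pauli_projector_mult[OF car] trace_pauli_projector_mult[OF car'(1)]
    trace_pauli_projector_mult[OF car'(2)] trace_pauli_projector_mult[OF car'(3)]
  note simps = u_def v_def w_def w'_def traces pauli_mat_mult_index[OF car] pauli_mat_mult_index[OF car'(1)]
    e[simplified] complex_eq_iff Let_def
  show "u b = of_real (Re (u b))"
    using P by (cases P; cases b; simp add: simps del: pauli_mat.simps index_mult_mat)
  show "v b = of_real (Re (v b))"
    using P by (cases R; cases P; cases b; simp add: simps del: pauli_mat.simps index_mult_mat)
  show "w' b = cnj (w b)"
    using P by (cases R; cases P; cases b; simp add: simps del: pauli_mat.simps index_mult_mat)
  show "u True + u False = 1"
    using P by (cases P; simp add: simps add_divide_distrib diff_divide_distrib del: pauli_mat.simps index_mult_mat)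
  show "v True + v False = 1"
    using P by (cases R; cases P; simp add: simps add_divide_distrib diff_divide_distrib del: pauli_mat.simps index_mult_mat)
  show "Im (w True + w False) = 0"
    using P by (cases R; cases P; simp add: simps add_divide_distrib diff_divide_distrib del: pauli_mat.simps index_mult_mat)
  show "Re (u b) \<ge> 0"
    using P a x y by (cases P; cases b; simp add: simps del: pauli_mat.simps index_mult_mat)
  show "Re (v b) \<ge> 0"
    using P a x y by (cases R; cases P; cases b; simp add: simps del: pauli_mat.simps index_mult_mat)
  show "(cmod (w b))\<^sup>2 \<le> Re (u b) * Re (v b)"
    unfolding cmod_power2
    using P a x y xy
    by (cases R; cases P; cases b; simp add: simps del: pauli_mat.simps index_mult_mat;
      simp add: power2_eq_square field_simps)
qed

section \<open>One shot\<close>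

lemma sum_lists_length_Suc:
  "(\<Sum>bs\<in>{bs :: 'a list. length bs = Suc n}. f bs) =
   (\<Sum>b\<in>UNIV. \<Sum>bs\<in>{bs. length bs = n}. f (b # bs))"
proof -
  have "{bs :: 'a list. length bs = Suc n} = (\<lambda>(b, bs). b # bs) ` (UNIV \<times> {bs. length bs = n})"
    by (auto simp: length_Suc_conv image_iff)
  then show ?thesis
    by (simp add: sum.reindex inj_on_def sum.cartesian_product split_def)
qed

text \<open>Distributivity, by splitting off the first entry. It carries normalisation from single
  qubits to the distribution of the whole outcome string.\<close>

lemma sum_lists_prod:
  fixes f :: "nat \<Rightarrow> 'a::finite \<Rightarrow> 'b::comm_semiring_1"
  shows "(\<Sum>bs | length bs = n. \<Prod>q<n. f q (bs ! q)) = (\<Prod>q<n. \<Sum>b\<in>UNIV. f q b)"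
proof (induction n arbitrary: f)
  case (Suc n)
  have "(\<Sum>bs | length bs = Suc n. \<Prod>q<Suc n. f q (bs ! q)) =
      (\<Sum>b\<in>UNIV. \<Sum>bs | length bs = n. f 0 b * (\<Prod>q<n. f (Suc q) (bs ! q)))"
    by (simp add: sum_lists_length_Suc prod.lessThan_Suc_shift del: prod.lessThan_Suc)
  also have "\<dots> = (\<Sum>b\<in>UNIV. f 0 b) * (\<Prod>q<n. \<Sum>b\<in>UNIV. f (Suc q) b)"
    by (simp add: sum_distrib_left[symmetric] sum_distrib_right[symmetric] Suc[of "\<lambda>q. f (Suc q)"])
  finally show ?case by (simp add: prod.lessThan_Suc_shift del: prod.lessThan_Suc)
qed simp

lemma trace_tensor_list_mult:
  assumes "length As = n" "length Bs = n" "set As \<subseteq> carrier_mat d d" "set Bs \<subseteq> carrier_mat d d"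
  shows "trace (tensor_list As * tensor_list Bs) = (\<Prod>q<n. trace (As ! q * Bs ! q))"
  using assms by (simp add: tensor_list_mult trace_tensor_list[OF set_map2_mult_carrier])

lemma trace_mult_sandwich_comb:
  assumes T: "T \<in> carrier_mat d d" and R: "R \<in> carrier_mat d d" and M: "M \<in> carrier_mat d d"
  shows "trace (T * sandwich_comb R M x y p q) =
    x * trace (T * M) + y * trace (T * (R * M * R)) + p * trace (T * (R * M)) + q * trace (T * (M * R))"
proof -
  have car: "R * M * R \<in> carrier_mat d d" "R * M \<in> carrier_mat d d" "M * R \<in> carrier_mat d d"
    using R M by auto
  show ?thesis
    unfolding trace_mult[OF T sandwich_comb_carrier[OF R M]] trace_mult[OF T M] trace_mult[OF T car(1)]
      trace_mult[OF T car(2)] trace_mult[OF T car(3)] sum_distrib_left sum.distrib[symmetric]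
    by (intro sum.cong refl) (simp add: sandwich_comb_index[OF R M] algebra_simps del: index_mult_mat)
qed

text \<open>The functions are obtained before \<open>\<theta>\<close> is chosen, so the same ones
  serve for both signs of \<open>\<theta>\<close>; changing the sign only flips the interference
  term.\<close>

lemma shot_prob_hamiltonian:
  assumes R: "R \<in> pauli_strings n" and s: "valid_setting n tmax s"
  obtains u v w :: "outcome \<Rightarrow> real" where
    "\<And>\<theta> b. length b = n \<Longrightarrow> shot_prob n (hamiltonian_generator R \<theta>) s b =
       (cos (\<theta> * duration s))\<^sup>2 * u b + (sin (\<theta> * duration s))\<^sup>2 * v b -
       2 * sin (\<theta> * duration s) * cos (\<theta> * duration s) * w b"
    "\<And>b. length b = n \<Longrightarrow> 0 \<le> u b" "\<And>b. length b = n \<Longrightarrow> 0 \<le> v b"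
    "\<And>b. length b = n \<Longrightarrow> (w b)\<^sup>2 \<le> u b * v b"
    "(\<Sum>b | length b = n. u b) = 1" "(\<Sum>b | length b = n. v b) = 1" "(\<Sum>b | length b = n. w b) = 0"
proof -
  let ?\<rho> = "input_factors s" and ?P = "bases s" and ?m = "map pauli_mat R"
  have len: "length R = n" "length ?\<rho> = n" "length ?P = n"
    using R s by (auto simp: pauli_strings_def valid_setting_def)
  have dens: "density_matrix 2 (?\<rho> ! q)" if "q < n" for q
    using s that nth_mem[of q "?\<rho>"] by (auto simp: valid_setting_def)
  have nI: "?P ! q \<noteq> PauliI" if "q < n" for q
  proof -
    have "?P ! q \<in> set ?P" "set ?P \<subseteq> {PauliX, PauliY, PauliZ}"
      using s that by (auto simp: valid_setting_def)
    then show ?thesis by (metis empty_iff insert_iff pauli.distinct subsetD)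
  qed
  have \<rho>c: "set ?\<rho> \<subseteq> carrier_mat 2 2"
    using s by (auto simp: valid_setting_def density_matrix_def)
  define uq where "uq q b = trace (pauli_projector (?P ! q) b * ?\<rho> ! q)" for q b
  define vq where "vq q b = trace (pauli_projector (?P ! q) b *
    (pauli_mat (R ! q) * ?\<rho> ! q * pauli_mat (R ! q)))" for q b
  define wq where "wq q b = trace (pauli_projector (?P ! q) b * (?\<rho> ! q * pauli_mat (R ! q)))" for q b
  have qubit: "uq q b = of_real (Re (uq q b))" "vq q b = of_real (Re (vq q b))"
      "trace (pauli_projector (?P ! q) b * (pauli_mat (R ! q) * ?\<rho> ! q)) = cnj (wq q b)"
      "Re (uq q b) \<ge> 0" "Re (vq q b) \<ge> 0" "(cmod (wq q b))\<^sup>2 \<le> Re (uq q b) * Re (vq q b)"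
      "uq q True + uq q False = 1" "vq q True + vq q False = 1" "Im (wq q True + wq q False) = 0"
    if "q < n" for q b
    unfolding uq_def vq_def wq_def by (rule qubit_shot_statistics[OF dens[OF that] nI[OF that]])+
  define u where "u b = (\<Prod>q<n. Re (uq q (b ! q)))" for b :: outcome
  define v where "v b = (\<Prod>q<n. Re (vq q (b ! q)))" for b :: outcome
  \<comment> \<open>The imaginary part is taken after the product over the qubits, since only the
    complex interference terms are multiplicative.\<close>
  define w where "w b = Im (\<Prod>q<n. wq q (b ! q))" for b :: outcome
  have prob: "shot_prob n (hamiltonian_generator R \<theta>) s b =
       (cos (\<theta> * duration s))\<^sup>2 * u b + (sin (\<theta> * duration s))\<^sup>2 * v b -
       2 * sin (\<theta> * duration s) * cos (\<theta> * duration s) * w b"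
    if b: "length b = n" for \<theta> b
  proof -
    let ?\<Pi> = "map2 pauli_projector ?P b"
    let ?T = "tensor_list ?\<Pi>" and ?M = "tensor_list ?\<rho>" and ?R = "pauli_string_mat R"
    have \<Pi>c: "set ?\<Pi> \<subseteq> carrier_mat 2 2" by auto
    have Mc: "?M \<in> carrier_mat (2 ^ n) (2 ^ n)" and Tc: "?T \<in> carrier_mat (2 ^ n) (2 ^ n)"
      using tensor_list_carrier[OF \<rho>c] tensor_list_carrier[OF \<Pi>c] len b by auto
    note Rc = pauli_string_mat_carrier[OF R]
    let ?R\<rho> = "map2 (*) ?m ?\<rho>" and ?\<rho>R = "map2 (*) ?\<rho> ?m"
    have car: "set ?R\<rho> \<subseteq> carrier_mat 2 2" "set ?\<rho>R \<subseteq> carrier_mat 2 2"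
        "set (map2 (*) ?R\<rho> ?m) \<subseteq> carrier_mat 2 2"
      by (intro set_map2_mult_carrier set_map_pauli_mat \<rho>c)+
    have ten: "?R * ?M = tensor_list ?R\<rho>" "?M * ?R = tensor_list ?\<rho>R"
        "?R * ?M * ?R = tensor_list (map2 (*) ?R\<rho> ?m)"
      using len tensor_list_mult[OF _ set_map_pauli_mat \<rho>c] tensor_list_mult[OF _ \<rho>c set_map_pauli_mat]
        tensor_list_mult[OF _ car(1) set_map_pauli_mat]
      by (simp_all add: pauli_string_mat_def)
    have "trace (?T * ?M) = (\<Prod>q<n. uq q (b ! q))"
      using len b trace_tensor_list_mult[OF _ _ \<Pi>c \<rho>c] by (simp add: uq_def)
    also have "\<dots> = (\<Prod>q<n. of_real (Re (uq q (b ! q))))"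
      using qubit(1) by (intro prod.cong refl) simp
    finally have tu: "trace (?T * ?M) = of_real (u b)" by (simp add: u_def)
    have "trace (?T * (?R * ?M * ?R)) = (\<Prod>q<n. vq q (b ! q))"
      unfolding ten(3) using len b trace_tensor_list_mult[OF _ _ \<Pi>c car(3)] by (simp add: vq_def)
    also have "\<dots> = (\<Prod>q<n. of_real (Re (vq q (b ! q))))"
      using qubit(2) by (intro prod.cong refl) simp
    finally have tv: "trace (?T * (?R * ?M * ?R)) = of_real (v b)" by (simp add: v_def)
    have tw: "trace (?T * (?M * ?R)) = (\<Prod>q<n. wq q (b ! q))"
      unfolding ten(2) using len b trace_tensor_list_mult[OF _ _ \<Pi>c car(2)] by (simp add: wq_def)
    have "trace (?T * (?R * ?M)) = (\<Prod>q<n. cnj (wq q (b ! q)))"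
      unfolding ten(1) using len b trace_tensor_list_mult[OF _ _ \<Pi>c car(1)] qubit(3) by simp
    then have tw': "trace (?T * (?R * ?M)) = cnj (\<Prod>q<n. wq q (b ! q))" by simp
    define c where "c = cos (\<theta> * duration s)"
    define \<sigma> where "\<sigma> = sin (\<theta> * duration s)"
    have "shot_prob n (hamiltonian_generator R \<theta>) s b =
      Re ((of_real c)\<^sup>2 * of_real (u b) + (of_real \<sigma>)\<^sup>2 * of_real (v b) +
        (- \<i> * of_real \<sigma> * of_real c) * cnj (\<Prod>q<n. wq q (b ! q)) +
        (\<i> * of_real \<sigma> * of_real c) * (\<Prod>q<n. wq q (b ! q)))"
      unfolding shot_prob_def superop_exp_hamiltonian[OF R Mc] trace_mult_sandwich_comb[OF Tc Rc Mc]
        tu tv tw tw' c_def \<sigma>_def ..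
    also have "\<dots> = c\<^sup>2 * u b + \<sigma>\<^sup>2 * v b - 2 * \<sigma> * c * w b"
    proof -
      \<comment> \<open>The two cross terms carry conjugate traces with opposite coefficients, so
        only the imaginary part of \<open>z\<close> survives, with factor -2.\<close>
      have "Re ((of_real c)\<^sup>2 * of_real (u b) + (of_real \<sigma>)\<^sup>2 * of_real (v b) +
        (- \<i> * of_real \<sigma> * of_real c) * cnj z + (\<i> * of_real \<sigma> * of_real c) * z) =
        c\<^sup>2 * u b + \<sigma>\<^sup>2 * v b - 2 * \<sigma> * c * Im z" for z
        by (simp flip: of_real_power)
      then show ?thesis unfolding w_def .
    qed
    finally show ?thesis unfolding c_def \<sigma>_def .
  qed
  have "(w b)\<^sup>2 \<le> u b * v b" for b
  proof -
    \<comment> \<open>Passing to the modulus restores multiplicativity, so the bound can be applied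
      qubit by qubit.\<close>
    have "(w b)\<^sup>2 \<le> (cmod (\<Prod>q<n. wq q (b ! q)))\<^sup>2"
      by (simp add: w_def cmod_power2)
    also have "\<dots> = (\<Prod>q<n. (cmod (wq q (b ! q)))\<^sup>2)"
      by (simp add: prod_norm[symmetric] prod_power_distrib)
    also have "\<dots> \<le> (\<Prod>q<n. Re (uq q (b ! q)) * Re (vq q (b ! q)))"
      using qubit(6) by (intro prod_mono) simp
    finally show ?thesis by (simp add: u_def v_def prod.distrib)
  qed
  moreover have "0 \<le> u b" "0 \<le> v b" for b
    using qubit(4,5) by (auto simp: u_def v_def intro!: prod_nonneg)
  moreover have "(\<Sum>b | length b = n. u b) = 1"
    using arg_cong[OF qubit(7), of _ Re]
    by (simp add: u_def sum_lists_prod[where f = "\<lambda>q b. Re (uq q b)"] UNIV_bool add.commute)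
  moreover have "(\<Sum>b | length b = n. v b) = 1"
    using arg_cong[OF qubit(8), of _ Re]
    by (simp add: v_def sum_lists_prod[where f = "\<lambda>q b. Re (vq q b)"] UNIV_bool add.commute)
  moreover have "(\<Sum>b | length b = n. w b) = 0"
  proof -
    \<comment> \<open>Summing over all outcome strings gives a product of one-qubit sums, each of
      them real, so its imaginary part vanishes.\<close>
    have "(\<Prod>q<n. wq q False + wq q True) \<in> \<real>"
      using qubit(9) by (intro prod_in_Reals) (simp add: complex_is_Real_iff add.commute)
    then show ?thesis
      by (simp add: w_def Im_sum[symmetric] sum_lists_prod[where f = wq] UNIV_bool complex_is_Real_iff
          del: Im_sum)
  qed
  ultimately show ?thesis
    using that[of u v w] prob by blast
qed

text \<open>These are the values of the quadratic form of the state at \<open>c I \<plusminus> \<i> s R\<close>; the second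
  bound is Cauchy--Schwarz for that form.\<close>

lemma sqrt_conjugate_probs:
  fixes c s u v w :: real
  assumes "0 \<le> u" "0 \<le> v" "w\<^sup>2 \<le> u * v"
  shows "\<bar>2 * s * c * w\<bar> \<le> c\<^sup>2 * u + s\<^sup>2 * v"
    and "c\<^sup>2 * u - s\<^sup>2 * v \<le>
      sqrt ((c\<^sup>2 * u + s\<^sup>2 * v - 2 * s * c * w) * (c\<^sup>2 * u + s\<^sup>2 * v + 2 * s * c * w))"
proof -
  have "(2 * s * c * w)\<^sup>2 = 4 * (s\<^sup>2 * c\<^sup>2) * w\<^sup>2" by (simp add: power_mult_distrib)
  also have "\<dots> \<le> 4 * (s\<^sup>2 * c\<^sup>2) * (u * v)" using assms by (intro mult_left_mono) auto
  also have "\<dots> = (c\<^sup>2 * u + s\<^sup>2 * v)\<^sup>2 - (c\<^sup>2 * u - s\<^sup>2 * v)\<^sup>2"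
    by (simp add: power2_eq_square algebra_simps)
  finally have *: "(2 * s * c * w)\<^sup>2 \<le> (c\<^sup>2 * u + s\<^sup>2 * v)\<^sup>2 - (c\<^sup>2 * u - s\<^sup>2 * v)\<^sup>2" .
  then have "(2 * s * c * w)\<^sup>2 \<le> (c\<^sup>2 * u + s\<^sup>2 * v)\<^sup>2"
    using zero_le_power2[of "c\<^sup>2 * u - s\<^sup>2 * v"] by linarith
  then show "\<bar>2 * s * c * w\<bar> \<le> c\<^sup>2 * u + s\<^sup>2 * v"
    using assms by (simp add: abs_le_square_iff[symmetric])
  show "c\<^sup>2 * u - s\<^sup>2 * v \<le>
      sqrt ((c\<^sup>2 * u + s\<^sup>2 * v - 2 * s * c * w) * (c\<^sup>2 * u + s\<^sup>2 * v + 2 * s * c * w))"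
    \<comment> \<open>The product under the root is a difference of two squares, so \<open>*\<close>
      is exactly the required comparison of squares.\<close>
    using * by (intro real_le_rsqrt) (simp add: power2_eq_square algebra_simps)
qed

text \<open>Positivity and normalisation are read off the trigonometric form of the probabilities.
  For the affinity, the pointwise bound on the geometric mean is summed over the outcomes, and
  normalisation of \<open>u\<close> and \<open>v\<close> leaves the cosine of the doubled
  angle.\<close>

lemma shot_prob_affinity:
  assumes R: "R \<in> pauli_strings n" and s: "valid_setting n tmax s"
  shows "length b = n \<Longrightarrow> 0 \<le> shot_prob n (hamiltonian_generator R \<theta>) s b"
    and "(\<Sum>b | length b = n. shot_prob n (hamiltonian_generator R \<theta>) s b) = 1"
    and "(\<Sum>b | length b = n. sqrt (shot_prob n (hamiltonian_generator R \<theta>) s b *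
      shot_prob n (hamiltonian_generator R (- \<theta>)) s b)) \<ge> 1 - 2 * (\<theta> * tmax)\<^sup>2"
proof -
  obtain u v w where prob: "\<And>\<theta> b. length b = n \<Longrightarrow> shot_prob n (hamiltonian_generator R \<theta>) s b =
       (cos (\<theta> * duration s))\<^sup>2 * u b + (sin (\<theta> * duration s))\<^sup>2 * v b -
       2 * sin (\<theta> * duration s) * cos (\<theta> * duration s) * w b"
    and nonneg: "\<And>b. length b = n \<Longrightarrow> 0 \<le> u b" "\<And>b. length b = n \<Longrightarrow> 0 \<le> v b"
      "\<And>b. length b = n \<Longrightarrow> (w b)\<^sup>2 \<le> u b * v b"
    and sums: "(\<Sum>b | length b = n. u b) = 1" "(\<Sum>b | length b = n. v b) = 1"
      "(\<Sum>b | length b = n. w b) = 0"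
    by (rule shot_prob_hamiltonian[OF R s], rule that; simp)
  define c where "c = cos (\<theta> * duration s)"
  define \<sigma> where "\<sigma> = sin (\<theta> * duration s)"
  have cs: "c\<^sup>2 = 1 - \<sigma>\<^sup>2" by (simp add: c_def \<sigma>_def cos_squared_eq)
  have plus: "shot_prob n (hamiltonian_generator R \<theta>) s b = c\<^sup>2 * u b + \<sigma>\<^sup>2 * v b - 2 * \<sigma> * c * w b"
    and minus: "shot_prob n (hamiltonian_generator R (- \<theta>)) s b = c\<^sup>2 * u b + \<sigma>\<^sup>2 * v b + 2 * \<sigma> * c * w b"
    if "length b = n" for b
    using prob[OF that] by (simp_all add: c_def \<sigma>_def)
  show "0 \<le> shot_prob n (hamiltonian_generator R \<theta>) s b" if "length b = n"
    using plus[OF that] sqrt_conjugate_probs(1)[OF nonneg[OF that], of \<sigma> c] by linarith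
  show "(\<Sum>b | length b = n. shot_prob n (hamiltonian_generator R \<theta>) s b) = 1"
    by (simp add: plus sum.distrib sum_subtractf sum_distrib_left[symmetric] sums cs)
  have "\<sigma>\<^sup>2 \<le> (\<theta> * duration s)\<^sup>2"
    unfolding \<sigma>_def using abs_sin_x_le_abs_x by (simp add: abs_le_square_iff)
  also have "\<dots> \<le> (\<theta> * tmax)\<^sup>2"
    using s by (auto simp: valid_setting_def power_mult_distrib intro!: mult_left_mono power_mono)
  finally have "1 - 2 * (\<theta> * tmax)\<^sup>2 \<le> c\<^sup>2 - \<sigma>\<^sup>2"
    by (simp add: cs)
  also have "\<dots> = (\<Sum>b | length b = n. c\<^sup>2 * u b - \<sigma>\<^sup>2 * v b)"
    by (simp add: sum_subtractf sum_distrib_left[symmetric] sums)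
  also have "\<dots> \<le> (\<Sum>b | length b = n. sqrt (shot_prob n (hamiltonian_generator R \<theta>) s b *
      shot_prob n (hamiltonian_generator R (- \<theta>)) s b))"
    using sqrt_conjugate_probs(2)[OF nonneg] by (intro sum_mono) (simp add: plus minus)
  finally show "(\<Sum>b | length b = n. sqrt (shot_prob n (hamiltonian_generator R \<theta>) s b *
      shot_prob n (hamiltonian_generator R (- \<theta>)) s b)) \<ge> 1 - 2 * (\<theta> * tmax)\<^sup>2" .
qed

section \<open>Adaptive protocols\<close>

lemma finite_outcomes [simp]: "finite {b :: outcome. length b = n}"
  using finite_lists_length_eq[of "UNIV :: bool set" n] by simp

lemma finite_outcome_seqs [simp]: "finite (outcome_seqs n m)"
proof -
  have "outcome_seqs n m = {os. set os \<subseteq> {b. length b = n} \<and> length os = m}"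
    by (auto simp: outcome_seqs_def)
  then show ?thesis by (simp add: finite_lists_length_eq)
qed

lemma sum_outcome_seqs_Suc:
  "(\<Sum>os\<in>outcome_seqs n (Suc m). f os) = (\<Sum>os\<in>outcome_seqs n m. \<Sum>b | length b = n. f (os @ [b]))"
proof -
  have "outcome_seqs n (Suc m) = (\<lambda>(os, b). os @ [b]) ` (outcome_seqs n m \<times> {b. length b = n})"
    by (force simp: outcome_seqs_def length_Suc_conv_rev image_iff)
  then show ?thesis
    by (simp add: sum.reindex inj_on_def sum.cartesian_product split_def)
qed

lemma path_prob_snoc:
  "path_prob n L p \<omega> (os @ [b]) = path_prob n L p \<omega> os * shot_prob n L (next_setting p \<omega> os) b"
  by (simp add: path_prob_def nth_append)

text \<open>The seed is fixed and the induction appends the last shot. Given the history, both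
  generators face the same setting, and the one-shot bound is uniform over valid settings, so
  adaptive choices cannot improve it. The linear form of the bound spares a sign condition on the
  factor lost per shot.\<close>

lemma path_prob_affinity:
  assumes R: "R \<in> pauli_strings n"
    and valid: "\<forall>m < N. \<forall>os \<in> outcome_seqs n m. valid_setting n tmax (next_setting p \<omega> os)"
    and "m \<le> N"
  shows "os \<in> outcome_seqs n m \<Longrightarrow> 0 \<le> path_prob n (hamiltonian_generator R \<theta>) p \<omega> os"
    and "(\<Sum>os\<in>outcome_seqs n m. path_prob n (hamiltonian_generator R \<theta>) p \<omega> os) = 1"
    and "(\<Sum>os\<in>outcome_seqs n m. sqrt (path_prob n (hamiltonian_generator R \<theta>) p \<omega> os *
      path_prob n (hamiltonian_generator R (- \<theta>)) p \<omega> os)) \<ge> 1 - m * (2 * (\<theta> * tmax)\<^sup>2)"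
proof -
  let ?p = "\<lambda>\<theta>. path_prob n (hamiltonian_generator R \<theta>) p \<omega>"
  let ?q = "\<lambda>\<theta> os. shot_prob n (hamiltonian_generator R \<theta>) (next_setting p \<omega> os)"
  have nonneg: "os \<in> outcome_seqs n m \<Longrightarrow> 0 \<le> ?p \<theta> os" if "m \<le> N" for \<theta> m os
    unfolding path_prob_def
  proof (rule prod_nonneg)
    fix j assume os: "os \<in> outcome_seqs n m" and j: "j \<in> {..<length os}"
    have "take j os \<in> outcome_seqs n j" "length (os ! j) = n" "j < N"
      using os j that by (auto simp: outcome_seqs_def dest: in_set_takeD)
    then show "0 \<le> shot_prob n (hamiltonian_generator R \<theta>) (next_setting p \<omega> (take j os)) (os ! j)"
      using shot_prob_affinity(1)[OF R valid[rule_format]] by blast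
  qed
  then show "os \<in> outcome_seqs n m \<Longrightarrow> 0 \<le> ?p \<theta> os" using \<open>m \<le> N\<close> by blast
  have total: "(\<Sum>os\<in>outcome_seqs n m. ?p \<theta> os) = 1" if "m \<le> N" for \<theta> m
    using that
  proof (induction m)
    case 0
    then show ?case by (simp add: outcome_seqs_def path_prob_def cong: conj_cong)
  next
    case (Suc m)
    then have "m < N" by simp
    then have "(\<Sum>os\<in>outcome_seqs n (Suc m). ?p \<theta> os) = (\<Sum>os\<in>outcome_seqs n m. ?p \<theta> os)"
      unfolding sum_outcome_seqs_Suc path_prob_snoc sum_distrib_left[symmetric]
      using shot_prob_affinity(2)[OF R valid[rule_format]] by (intro sum.cong refl) simp
    then show ?case using Suc by simp
  qed
  then show "(\<Sum>os\<in>outcome_seqs n m. ?p \<theta> os) = 1" using \<open>m \<le> N\<close> .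
  let ?x = "2 * (\<theta> * tmax)\<^sup>2"
  show "(\<Sum>os\<in>outcome_seqs n m. sqrt (?p \<theta> os * ?p (- \<theta>) os)) \<ge> 1 - m * ?x"
    using \<open>m \<le> N\<close>
  proof (induction m)
    case 0
    then show ?case by (simp add: outcome_seqs_def path_prob_def cong: conj_cong)
  next
    case (Suc m)
    then have "m < N" by simp
    let ?S = "outcome_seqs n m" and ?r = "\<lambda>os. sqrt (?p \<theta> os * ?p (- \<theta>) os)"
    \<comment> \<open>By AM-GM and normalisation the affinity so far is at most 1, so multiplying it
      by \<open>1 - ?x\<close> costs at most \<open>?x\<close>.\<close>
    have "(\<Sum>os\<in>?S. ?r os) \<le> (\<Sum>os\<in>?S. (?p \<theta> os + ?p (- \<theta>) os) / 2)"
      using nonneg[of m] Suc.prems by (intro sum_mono arith_geo_mean_sqrt) auto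
    also have "\<dots> = 1"
      using total[of m] Suc.prems by (simp add: sum_divide_distrib[symmetric] sum.distrib)
    finally have le1: "(\<Sum>os\<in>?S. ?r os) * ?x \<le> 1 * ?x"
      by (intro mult_right_mono) auto
    have "1 - Suc m * ?x \<le> (\<Sum>os\<in>?S. ?r os) - (\<Sum>os\<in>?S. ?r os) * ?x"
      using Suc le1 by (simp add: algebra_simps)
    also have "\<dots> = (\<Sum>os\<in>?S. ?r os * (1 - ?x))"
      by (simp add: sum_distrib_right right_diff_distrib sum_subtractf)
    also have "\<dots> \<le> (\<Sum>os\<in>?S. ?r os * (\<Sum>b | length b = n. sqrt (?q \<theta> os b * ?q (- \<theta>) os b)))"
      using \<open>m < N\<close> nonneg[of m] shot_prob_affinity(3)[OF R valid[rule_format]]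
      by (intro sum_mono mult_left_mono) auto
    also have "\<dots> = (\<Sum>os\<in>outcome_seqs n (Suc m). ?r os)"
      by (simp add: sum_outcome_seqs_Suc path_prob_snoc sum_distrib_left real_sqrt_mult mult_ac)
    finally show ?case .
  qed
qed

text \<open>Limits how well disjoint acceptance sets can separate two distributions with large
  affinity. The bound is linear in the affinity, so the estimate for a fixed seed is easily
  averaged.\<close>

lemma affinity_test_bound:
  fixes f g :: "'a \<Rightarrow> real"
  assumes S: "finite S" and f: "\<And>x. x \<in> S \<Longrightarrow> 0 \<le> f x" and g: "\<And>x. x \<in> S \<Longrightarrow> 0 \<le> g x"
    and total: "sum f S = 1" "sum g S = 1" and AB: "A \<subseteq> S" "B \<subseteq> S" "A \<inter> B = {}"
  shows "sum f A + sum g B \<le> 6 / 5 + 12 / 5 * (1 - (\<Sum>x\<in>S. sqrt (f x * g x)))"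
proof -
  \<comment> \<open>Weighted AM-GM; with weight 2/3 the resulting bound on the affinity stays below 1 when
    both error probabilities are at most 1/3.\<close>
  have amgm: "sqrt (a * b) \<le> a / 3 + 3 / 4 * b" if "0 \<le> a" "0 \<le> b" for a b :: real
  proof (rule real_le_lsqrt)
    have "(a / 3 + 3 / 4 * b)\<^sup>2 - a * b = (a / 3 - 3 / 4 * b)\<^sup>2"
      by (simp add: power2_eq_square algebra_simps)
    then show "a * b \<le> (a / 3 + 3 / 4 * b)\<^sup>2"
      using zero_le_power2[of "a / 3 - 3 / 4 * b"] by linarith
  qed (use that in auto)
  have amgm': "sqrt (a * b) \<le> b / 3 + 3 / 4 * a" if "0 \<le> a" "0 \<le> b" for a b :: real
    using amgm[OF that(2,1)] by (simp add: mult.commute)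
  have split: "sum h S = sum h A + sum h (S - A)" for h :: "'a \<Rightarrow> real"
    using sum.subset_diff[OF AB(1) S, of h] by simp
  \<comment> \<open>The light weight 1/3 goes to the distribution favoured by the test: to
    \<open>f\<close> on \<open>A\<close> and to \<open>g\<close> off \<open>A\<close>.\<close>
  have "(\<Sum>x\<in>S. sqrt (f x * g x)) \<le>
      (\<Sum>x\<in>A. f x / 3 + 3 / 4 * g x) + (\<Sum>x\<in>S - A. g x / 3 + 3 / 4 * f x)"
    unfolding split
    using AB(1) by (intro add_mono sum_mono amgm amgm' f g) auto
  also have "\<dots> = sum f A / 3 + 3 / 4 * sum g A + sum g (S - A) / 3 + 3 / 4 * sum f (S - A)"
    by (simp add: sum.distrib sum_distrib_left sum_divide_distrib)
  finally have "(\<Sum>x\<in>S. sqrt (f x * g x)) \<le>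
      sum f A / 3 + 3 / 4 * sum g A + sum g (S - A) / 3 + 3 / 4 * sum f (S - A)" .
  moreover have "sum g B \<le> sum g (S - A)"
    using AB S g by (intro sum_mono2) auto
  \<comment> \<open>Eliminating \<open>a'\<close> gives
    \<open>r \<le> 3 / 2 - 5 / 12 * (a + b')\<close>; solving for \<open>a + b'\<close> yields the
    constants 6/5 and 12/5.\<close>
  moreover have "a + b \<le> 6 / 5 + 12 / 5 * (1 - r)"
    if "r \<le> a / 3 + 3 / 4 * a' + b' / 3 + 3 / 4 * (1 - a)" "b \<le> b'" "a' + b' = 1" for a a' b b' r :: real
    using that by (simp add: field_simps)
  ultimately show ?thesis
    using split[of f] split[of g] total by (simp add: algebra_simps)
qed

theorem theorem7p1:
  shows "\<exists>c::real. c > 0 \<and>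
    (\<forall>(n::nat) (k::nat) (R::pauli list) (\<epsilon>\<^sub>1::real) (tmax::real) (N::nat) (p::protocol).
       R \<in> pauli_strings n \<longrightarrow> R \<noteq> pauli_id n \<longrightarrow> card (pauli_supp R) \<le> k \<longrightarrow>
       \<epsilon>\<^sub>1 > 0 \<longrightarrow> tmax > 0 \<longrightarrow>
       valid_protocol n tmax N p \<longrightarrow>
       (\<forall>\<theta> \<in> {- 2 * \<epsilon>\<^sub>1, 2 * \<epsilon>\<^sub>1}.
          estimate_prob n (hamiltonian_generator R \<theta>) N p
            (\<lambda>x. cmod (x - chi_matrix n (hamiltonian_generator R \<theta>) R (pauli_id n)) \<le> \<epsilon>\<^sub>1)
          \<ge> 2 / 3) \<longrightarrow>
       real N \<ge> c / (tmax\<^sup>2 * \<epsilon>\<^sub>1\<^sup>2))"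
proof (intro exI[of _ "1 / 144"] conjI allI impI)
  fix n k :: nat and R :: "pauli list" and \<epsilon> tmax :: real and N :: nat and p :: protocol
  assume R: "R \<in> pauli_strings n" "R \<noteq> pauli_id n" and pos: "\<epsilon> > 0" "tmax > 0"
    and p: "valid_protocol n tmax N p"
    and success: "\<forall>\<theta> \<in> {- 2 * \<epsilon>, 2 * \<epsilon>}. estimate_prob n (hamiltonian_generator R \<theta>) N p
      (\<lambda>x. cmod (x - chi_matrix n (hamiltonian_generator R \<theta>) R (pauli_id n)) \<le> \<epsilon>) \<ge> 2 / 3"
  interpret prob_space "seed p" using p by (simp add: valid_protocol_def)
  define E where "E \<theta> \<omega> = {os \<in> outcome_seqs n N. cmod (estimate p \<omega> os - (- \<i> * of_real \<theta>)) \<le> \<epsilon>}"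
    for \<theta> \<omega>
  define h where "h \<theta> \<omega> = sum (path_prob n (hamiltonian_generator R \<theta>) p \<omega>) (E \<theta> \<omega>)" for \<theta> \<omega>
  have large: "integral\<^sup>L (seed p) (h \<theta>) \<ge> 2 / 3" if "\<theta> \<in> {- (2 * \<epsilon>), 2 * \<epsilon>}" for \<theta>
    using success that unfolding estimate_prob_def h_def E_def chi_matrix_hamiltonian[OF R] by auto
  \<comment> \<open>A non-integrable function would have integral 0.\<close>
  have int: "integrable (seed p) (h \<theta>)" if "\<theta> \<in> {- (2 * \<epsilon>), 2 * \<epsilon>}" for \<theta>
    using large[OF that] not_integrable_integral_eq[of "seed p" "h \<theta>"] by fastforce
  define C where "C = 6 / 5 + 12 / 5 * (N * (2 * (2 * \<epsilon> * tmax)\<^sup>2))"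
  \<comment> \<open>The testing argument runs for each seed separately; its constant bound is
    integrated over the seed afterwards.\<close>
  have bound: "h (2 * \<epsilon>) \<omega> + h (- (2 * \<epsilon>)) \<omega> \<le> C" if \<omega>: "\<omega> \<in> space (seed p)" for \<omega>
  proof -
    have valid: "\<forall>m < N. \<forall>os \<in> outcome_seqs n m. valid_setting n tmax (next_setting p \<omega> os)"
      using p \<omega> by (auto simp: valid_protocol_def)
    note path = path_prob_affinity[OF R(1) valid order_refl]
    \<comment> \<open>The two target coefficients lie on the imaginary axis at distance
      \<open>4 * \<epsilon>\<close>, so the discs of radius \<open>\<epsilon>\<close> around them
      are disjoint.\<close>
    have disj: "E (2 * \<epsilon>) \<omega> \<inter> E (- (2 * \<epsilon>)) \<omega> = {}"
    proof (rule ccontr)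
      assume "E (2 * \<epsilon>) \<omega> \<inter> E (- (2 * \<epsilon>)) \<omega> \<noteq> {}"
      then obtain x where "cmod (x - - \<i> * of_real (2 * \<epsilon>)) \<le> \<epsilon>" "cmod (x - - \<i> * of_real (- (2 * \<epsilon>))) \<le> \<epsilon>"
        by (auto simp: E_def)
      then have "\<bar>Im x + 2 * \<epsilon>\<bar> \<le> \<epsilon>" "\<bar>Im x - 2 * \<epsilon>\<bar> \<le> \<epsilon>"
        using abs_Im_le_cmod[of "x - - \<i> * of_real (2 * \<epsilon>)"]
          abs_Im_le_cmod[of "x - - \<i> * of_real (- (2 * \<epsilon>))"] by auto
      then show False using pos by linarith
    qed
    have "h (2 * \<epsilon>) \<omega> + h (- (2 * \<epsilon>)) \<omega> \<le> 6 / 5 + 12 / 5 * (1 - (\<Sum>os\<in>outcome_seqs n N.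
        sqrt (path_prob n (hamiltonian_generator R (2 * \<epsilon>)) p \<omega> os *
          path_prob n (hamiltonian_generator R (- (2 * \<epsilon>))) p \<omega> os)))"
      unfolding h_def using path disj by (intro affinity_test_bound) (auto simp: E_def)
    also have "\<dots> \<le> C"
      unfolding C_def using path(3)[where \<theta> = "2 * \<epsilon>"] by simp
    finally show ?thesis .
  qed
  have "4 / 3 \<le> integral\<^sup>L (seed p) (h (2 * \<epsilon>)) + integral\<^sup>L (seed p) (h (- (2 * \<epsilon>)))"
    using large[of "2 * \<epsilon>"] large[of "- (2 * \<epsilon>)"] by simp
  also have "\<dots> = (\<integral>\<omega>. h (2 * \<epsilon>) \<omega> + h (- (2 * \<epsilon>)) \<omega> \<partial>seed p)"
    using int by (intro Bochner_Integration.integral_add[symmetric]) auto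
  also have "\<dots> \<le> (\<integral>\<omega>. C \<partial>seed p)"
    using int bound by (intro integral_mono) auto
  also have "\<dots> = C" by (simp add: prob_space)
  \<comment> \<open>From \<open>4 / 3 \<le> C\<close> the total affinity loss is at least
    \<open>(4 / 3 - 6 / 5) * 5 / 12 = 1 / 18\<close>; each shot accounts for 8 times the square of
    \<open>\<epsilon> * tmax\<close>, and \<open>18 * 8 = 144\<close>.\<close>
  finally have "1 / 144 \<le> N * (tmax\<^sup>2 * \<epsilon>\<^sup>2)"
    by (simp add: C_def power_mult_distrib mult.commute[of "\<epsilon>\<^sup>2"])
  then show "1 / 144 / (tmax\<^sup>2 * \<epsilon>\<^sup>2) \<le> N"
    using pos by (simp add: pos_divide_le_eq)
qed simp

end
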